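(* Let $m\ge2$ be an integer and let $\omega_m$ be the $m$-th multinacci number. For $\lambda\in(0,1)$ define $\mathcal{C}_\lambda$ as the set of points of $\mathcal{S}_\lambda$ with less than a continuum of addresses, i.e. $$\mathcal{C}_\lambda:=\left\{\mathbf x\in\mathcal{S}_\lambda : \mathrm{card}\{\boldsymbol\varepsilon\in\Sigma^\infty:\mathbf x=\mathbf x_{\boldsymbol\varepsilon}\}<2^{\aleph_0}\right\}.$$ Then $$\dim_H(\mathcal{C}_{\omega_m})=\dim_H(\mathcal{U}_{\omega_m})<\dim_H(\mathcal{S}_{\omega_m}).$$
   Context: Let $\mathbf p_k=\frac23(\cos(2\pi k/3),\sin(2\pi k/3))\in\mathbb{R}^2$, $k=0,1,2$. For $\lambda\in(0,1)$ let $f_i(\mathbf x)=\lambda\mathbf x+(1-\lambda)\mathbf p_i$, $i=0,1,2$. The invariant set $\mathcal{S}_\lambda$ is the unique non-empty compact set with $\mathcal{S}_\lambda=\bigcup_{i=0}^2 f_i(\mathcal{S}_\lambda)$. Let $\Sigma=\{0,1,2\}$. To any $\boldsymbol\varepsilon=(\varepsilon_0,\varepsilon_1,\dots)\in\Sigma^\infty$ corresponds the point $\mathbf x_{\boldsymbol\varepsilon}=\lim_{n\to\infty}f_{\varepsilon_0}\cdots f_{\varepsilon_n}(\mathbf x_0)\in\mathcal{S}_\lambda$, which does not depend on $\mathbf x_0$; $\boldsymbol\varepsilon$ is called an address of $\mathbf x_{\boldsymbol\varepsilon}$. The set of uniqueness $\mathcal{U}_\lambda$ is the set of points $\mathbf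 x\in\mathcal{S}_\lambda$ having exactly one address $\boldsymbol\varepsilon\in\Sigma^\infty$. For $m\ge2$ the multinacci number $\omega_m$ is the unique positive root of $x^m+x^{m-1}+\cdots+x=1$. $\dim_H$ denotes Hausdorff dimension. *)

theory Defs
  imports "HOL-Analysis.Analysis" "HOL-Library.Equipollence"
begin

text \<open>
  The \<open>s\<close>-dimensional gauge of a set, with the usual conventions that the empty set has gauge
  0 and that \<open>diam\<^sup>0 = 1\<close> for nonempty sets. The case \<open>s = 0\<close> is separated because
  \<open>0 powr 0 = 0\<close>. Only meaningful for bounded sets, since \<open>diameter\<close> is
  unspecified on unbounded ones.
\<close>

definition hausdorff_gauge :: "real \<Rightarrow> 'a::metric_space set \<Rightarrow> ennreal" where
  "hausdorff_gauge s U =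
     (if U = {} then 0 else if s = 0 then 1 else ennreal (diameter U powr s))"

text \<open>Finite covers are included, since members of the sequence may be empty.\<close>

definition hausdorff_covers :: "real \<Rightarrow> 'a::metric_space set \<Rightarrow> (nat \<Rightarrow> 'a set) set" where
  "hausdorff_covers \<delta> A =
     {U. A \<subseteq> (\<Union>i. U i) \<and> (\<forall>i. bounded (U i) \<and> diameter (U i) \<le> \<delta>)}"

definition hausdorff_premeasure :: "real \<Rightarrow> real \<Rightarrow> 'a::metric_space set \<Rightarrow> ennreal" where
  "hausdorff_premeasure s \<delta> A = (INF U\<in>hausdorff_covers \<delta> A. \<Sum>i. hausdorff_gauge s (U i))"

text \<open>The premeasure is antitone in \<open>\<delta>\<close>, so the supremum is the limit as
  \<open>\<delta>\<close> tends to 0.\<close>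

definition hausdorff_measure :: "real \<Rightarrow> 'a::metric_space set \<Rightarrow> ennreal" where
  "hausdorff_measure s A = (SUP \<delta>\<in>{0<..}. hausdorff_premeasure s \<delta> A)"

definition hausdorff_dim :: "'a::metric_space set \<Rightarrow> ennreal" where
  "hausdorff_dim A = (INF s\<in>{s. 0 \<le> s \<and> hausdorff_measure s A = 0}. ennreal s)"

definition vertex :: "nat \<Rightarrow> real^2" where
  "vertex k = (2/3) *\<^sub>R vector [cos (2 * pi * real k / 3), sin (2 * pi * real k / 3)]"

definition ifs_map :: "real \<Rightarrow> nat \<Rightarrow> real^2 \<Rightarrow> real^2" where
  "ifs_map lam i x = lam *\<^sub>R x + (1 - lam) *\<^sub>R vertex i"

definition invariant_set :: "real \<Rightarrow> (real^2) set" where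
  "invariant_set lam =
     (THE S. S \<noteq> {} \<and> compact S \<and> S = (\<Union>i\<in>{0,1,2}. ifs_map lam i ` S))"

definition address_space :: "(nat \<Rightarrow> nat) set" where
  "address_space = {\<epsilon>. \<forall>n. \<epsilon> n \<in> {0,1,2}}"

text \<open>The composition \<open>f\<^bsub>\<epsilon> 0\<^esub> (f\<^bsub>\<epsilon> 1\<^esub> (\<dots> (f\<^bsub>\<epsilon> n\<^esub> x\<^sub>0)))\<close>;
  the map with index \<open>\<epsilon> n\<close> is applied first.\<close>

definition ifs_iterate :: "real \<Rightarrow> (nat \<Rightarrow> nat) \<Rightarrow> nat \<Rightarrow> real^2 \<Rightarrow> real^2" where
  "ifs_iterate lam \<epsilon> n x0 = foldr (\<lambda>k. ifs_map lam (\<epsilon> k)) [0..<Suc n] x0"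

definition address_point :: "real \<Rightarrow> (nat \<Rightarrow> nat) \<Rightarrow> real^2" where
  "address_point lam \<epsilon> = (THE x. \<forall>x0. (\<lambda>n. ifs_iterate lam \<epsilon> n x0) \<longlonglongrightarrow> x)"

definition addresses :: "real \<Rightarrow> real^2 \<Rightarrow> (nat \<Rightarrow> nat) set" where
  "addresses lam x = {\<epsilon> \<in> address_space. x = address_point lam \<epsilon>}"

definition uniqueness_set :: "real \<Rightarrow> (real^2) set" where
  "uniqueness_set lam = {x \<in> invariant_set lam. \<exists>!\<epsilon>. \<epsilon> \<in> addresses lam x}"

text \<open>The type \<open>nat set\<close> has cardinality exactly \<open>2\<close> to the power aleph-null.\<close>

definition less_than_continuum_set :: "real \<Rightarrow> (real^2) set" where
  "less_than_continuum_set lam =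
     {x \<in> invariant_set lam. addresses lam x \<prec> (UNIV :: nat set set)}"

definition multinacci :: "nat \<Rightarrow> real" where
  "multinacci m = (THE x. 0 < x \<and> (\<Sum>k=1..m. x ^ k) = 1)"

end

theory Submission
  imports Defs
begin

text \<open>
  Write \<open>\<lambda>\<close> for the multinacci number and \<open>f\<^sub>i\<close> for the three maps. The strict inequality rests on one
  identity: since \<open>\<lambda> + \<dots> + \<lambda>^m = 1\<close>, the map \<open>f\<^sub>i f\<^sub>j^m\<close> equals \<open>f\<^sub>j f\<^sub>i^m\<close>.

  The equality of dimensions is soft and holds for every ratio. The set of addresses of a point is
  closed in the sequence space. If no tail of any address of \<open>x\<close> leads to a point with a unique
  address, every address of \<open>x\<close> can be modified arbitrarily late, so the set of addresses has no
  isolated points and contains a Cantor set (\<open>continuum_lepoll_perfect\<close>). Hence a point with fewer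
  than continuum many addresses lies in an image \<open>f\<^sub>w(U)\<close> of the uniqueness set
  (\<open>less_than_continuum_subset\<close>). There are only countably many words \<open>w\<close>, and the maps are
  contractions, so Hausdorff null sets are the same for both sets.

  The strict inequality compares two growth rates.
  By the identity, a unique address never contains a symbol followed by \<open>m\<close> copies of a different
  symbol. The number of words of length \<open>n\<close> with this property grows at most like \<open>t^(-n)\<close> as soon
  as \<open>2(t + \<dots> + t^(m-1)) < 1\<close> (\<open>card_run_limited_words_growth\<close>), and covering by the
  corresponding cells bounds the dimension from above (\<open>hausdorff_dim_uniqueness_le\<close>).

  For the attractor, count distinct cells of level \<open>n\<close>. Two first-level pieces of the set of cells
  overlap exactly in the cells \<open>f\<^sub>i f\<^sub>j^m(\<dots>)\<close> (\<open>coords_corner\<close>), so the number \<open>q(n)\<close> of cells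
  satisfies \<open>q(n+1) \<ge> 3 q(n) - 3 q(n-m)\<close>, and therefore \<open>q(n) \<le> t q(n+1)\<close> whenever
  \<open>3t - 3t^(m+1) \<ge> 1\<close> (\<open>card_coords_ratio\<close>). Distinct cells of level \<open>n\<close> are \<open>(1-\<lambda>)\<lambda>^n\<close>-separated
  (\<open>coords_separated\<close>), so a ball of radius \<open>\<lambda>^n\<close> meets boundedly many of them. Given a cover of the
  compact attractor, counting the cells of one very deep level then shows that
  \<open>\<Sum> diam^s\<close> is bounded below when \<open>\<lambda>^s = t\<close>, so the dimension is at least \<open>s\<close>
  (\<open>hausdorff_measure_invariant_set_nonzero\<close>).

  At the root \<open>t\<^sub>0\<close> of \<open>2(t + \<dots> + t^(m-1)) = 1\<close>, equivalently \<open>3t = 1 + 2t^m\<close>, one has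
  \<open>3t - 3t^(m+1) - 1 = t^m (2 - 3t) > 0\<close>. So the second condition persists slightly below \<open>t\<^sub>0\<close>,
  where the first one already holds with room to spare (\<open>growth_rates_differ\<close>).
\<close>

section \<open>Hausdorff null sets and dimension\<close>

lemma hausdorff_nullI:
  assumes "\<And>\<delta> e. 0 < \<delta> \<Longrightarrow> 0 < e \<Longrightarrow>
             \<exists>U\<in>hausdorff_covers \<delta> A. (\<Sum>i. hausdorff_gauge s (U i)) \<le> ennreal e"
  shows "hausdorff_measure s A = 0"
proof -
  have "hausdorff_premeasure s \<delta> A \<le> 0" if "0 < \<delta>" for \<delta>
  proof (rule ennreal_le_epsilon)
    fix e :: real assume "0 < e"
    then obtain U where "U \<in> hausdorff_covers \<delta> A" "(\<Sum>i. hausdorff_gauge s (U i)) \<le> ennreal e"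
      using assms \<open>0 < \<delta>\<close> by blast
    then show "hausdorff_premeasure s \<delta> A \<le> 0 + ennreal e"
      unfolding hausdorff_premeasure_def by (auto intro: INF_lower2)
  qed
  then show ?thesis
    unfolding hausdorff_measure_def by (intro le_zero_eq[THEN iffD1] SUP_least) simp
qed

lemma hausdorff_nullE:
  assumes "hausdorff_measure s A = 0" "0 < \<delta>" "0 < e"
  obtains U where "U \<in> hausdorff_covers \<delta> A" "(\<Sum>i. hausdorff_gauge s (U i)) < ennreal e"
proof -
  have "hausdorff_premeasure s \<delta> A \<le> hausdorff_measure s A"
    unfolding hausdorff_measure_def using assms(2) by (intro SUP_upper) simp
  then have "hausdorff_premeasure s \<delta> A < ennreal e"
    using assms(1,3) by simp
  then show ?thesis
    using that unfolding hausdorff_premeasure_def INF_less_iff by blast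
qed

lemma hausdorff_null_mono:
  assumes "A \<subseteq> B" "hausdorff_measure s B = 0"
  shows "hausdorff_measure s A = 0"
proof (rule hausdorff_nullI)
  fix \<delta> e :: real assume "0 < \<delta>" "0 < e"
  from hausdorff_nullE[OF assms(2) this] obtain U
    where "U \<in> hausdorff_covers \<delta> B" "(\<Sum>i. hausdorff_gauge s (U i)) < ennreal e" .
  with \<open>A \<subseteq> B\<close> show "\<exists>U\<in>hausdorff_covers \<delta> A. (\<Sum>i. hausdorff_gauge s (U i)) \<le> ennreal e"
    by (intro bexI[of _ U]) (auto simp: hausdorff_covers_def)
qed

lemma suminf_ennreal_geometric:
  assumes "0 \<le> e"
  shows "(\<Sum>n. ennreal (e / 2 ^ Suc n)) = ennreal e"
proof -
  have "(\<lambda>n. e * (1/2) ^ Suc n) sums (e * 1)"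
    by (intro sums_mult power_half_series)
  then have "(\<lambda>n. e / 2 ^ Suc n) sums e"
    by (simp add: power_one_over field_simps)
  then show ?thesis
    using assms by (subst suminf_ennreal_eq) auto
qed

lemma hausdorff_null_UN:
  fixes A :: "nat \<Rightarrow> 'a::metric_space set"
  assumes "\<And>n. hausdorff_measure s (A n) = 0"
  shows "hausdorff_measure s (\<Union>n. A n) = 0"
proof (rule hausdorff_nullI)
  fix \<delta> e :: real assume "0 < \<delta>" "0 < e"
  have "\<exists>U\<in>hausdorff_covers \<delta> (A n).
      (\<Sum>i. hausdorff_gauge s (U i)) < ennreal (e / 2 ^ Suc n)" for n
    using hausdorff_nullE[OF assms[of n] \<open>0 < \<delta>\<close>, of "e / 2 ^ Suc n"] \<open>0 < e\<close> by auto
  then obtain U where U: "\<And>n. U n \<in> hausdorff_covers \<delta> (A n)"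
    "\<And>n. (\<Sum>i. hausdorff_gauge s (U n i)) < ennreal (e / 2 ^ Suc n)"
    by metis
  let ?V = "\<lambda>i. case prod_decode i of (n, k) \<Rightarrow> U n k"
  have "(\<Sum>i. hausdorff_gauge s (?V i)) = (\<Sum>n. \<Sum>k. hausdorff_gauge s (U n k))"
    using suminf_ennreal_2dimen[of "\<lambda>n. \<Sum>k. hausdorff_gauge s (U n k)"
        "\<lambda>(n,k). hausdorff_gauge s (U n k)"]
    by (simp add: case_prod_unfold)
  also have "\<dots> \<le> (\<Sum>n. ennreal (e / 2 ^ Suc n))"
    by (intro suminf_le less_imp_le[OF U(2)]) auto
  also have "\<dots> = ennreal e"
    using \<open>0 < e\<close> by (intro suminf_ennreal_geometric) simp
  finally have le: "(\<Sum>i. hausdorff_gauge s (?V i)) \<le> ennreal e" .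
  have "x \<in> (\<Union>i. ?V i)" if x: "x \<in> A n" for x n
  proof -
    obtain k where "x \<in> U n k" using U(1)[of n] x unfolding hausdorff_covers_def by blast
    then have "x \<in> ?V (prod_encode (n, k))" by simp
    then show ?thesis by (rule UN_I[OF UNIV_I])
  qed
  moreover have "bounded (U n k) \<and> diameter (U n k) \<le> \<delta>" for n k
    using U(1)[of n] unfolding hausdorff_covers_def by blast
  then have "bounded (?V i) \<and> diameter (?V i) \<le> \<delta>" for i
    by (simp add: case_prod_unfold)
  ultimately have "?V \<in> hausdorff_covers \<delta> (\<Union>n. A n)"
    unfolding hausdorff_covers_def by blast
  with le show "\<exists>U\<in>hausdorff_covers \<delta> (\<Union>n. A n). (\<Sum>i. hausdorff_gauge s (U i)) \<le> ennreal e"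
    by (intro bexI[of _ ?V])
qed

lemma diameter_image_le:
  fixes f :: "'a::metric_space \<Rightarrow> 'b::metric_space"
  assumes "\<And>x y. dist (f x) (f y) \<le> dist x y" "bounded U"
  shows "diameter (f ` U) \<le> diameter U"
proof (cases "U = {}")
  case False
  have "dist x y \<le> diameter U" if xy: "x \<in> f ` U" "y \<in> f ` U" for x y
  proof -
    obtain u v where "u \<in> U" "v \<in> U" "x = f u" "y = f v" using xy by blast
    then show ?thesis
      using order.trans[OF assms(1) diameter_bounded_bound[OF assms(2)]] by simp
  qed
  then have "(SUP (x, y) \<in> f ` U \<times> f ` U. dist x y) \<le> diameter U"
    using False by (intro cSUP_least) auto
  then show ?thesis
    using False by (simp add: diameter_def[of "f ` U"])
qed simp

lemma bounded_image_nonexpansive: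
  fixes f :: "'a::metric_space \<Rightarrow> 'b::metric_space"
  assumes "\<And>x y. dist (f x) (f y) \<le> dist x y" "bounded U"
  shows "bounded (f ` U)"
proof -
  obtain a e where "\<And>y. y \<in> U \<Longrightarrow> dist a y \<le> e"
    using assms(2) unfolding bounded_def by blast
  then have "\<forall>z\<in>f ` U. dist (f a) z \<le> e"
    using order.trans[OF assms(1)] by simp
  then show ?thesis unfolding bounded_def by blast
qed

lemma hausdorff_null_image:
  fixes f :: "'a::metric_space \<Rightarrow> 'b::metric_space"
  assumes lip: "\<And>x y. dist (f x) (f y) \<le> dist x y"
    and "0 \<le> s" "hausdorff_measure s A = 0"
  shows "hausdorff_measure s (f ` A) = 0"
proof (rule hausdorff_nullI)
  fix \<delta> e :: real assume "0 < \<delta>" "0 < e"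
  from hausdorff_nullE[OF assms(3) this] obtain U
    where U: "U \<in> hausdorff_covers \<delta> A" "(\<Sum>i. hausdorff_gauge s (U i)) < ennreal e" .
  have bd: "bounded (U i)" and d: "diameter (U i) \<le> \<delta>" for i
    using U(1) by (auto simp: hausdorff_covers_def)
  have "hausdorff_gauge s (f ` U i) \<le> hausdorff_gauge s (U i)" for i
    using diameter_image_le[OF lip bd] diameter_ge_0[OF bounded_image_nonexpansive[OF lip bd]] \<open>0 \<le> s\<close>
    by (auto simp: hausdorff_gauge_def intro!: ennreal_leI powr_mono2)
  then have "(\<Sum>i. hausdorff_gauge s (f ` U i)) \<le> (\<Sum>i. hausdorff_gauge s (U i))"
    by (intro suminf_le) auto
  also have "\<dots> \<le> ennreal e" using U(2) by simp
  finally have "(\<Sum>i. hausdorff_gauge s (f ` U i)) \<le> ennreal e" .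
  moreover have "A \<subseteq> (\<Union>i. U i)"
    using U(1) unfolding hausdorff_covers_def by blast
  then have "f ` A \<subseteq> (\<Union>i. f ` U i)" by blast
  then have "(\<lambda>i. f ` U i) \<in> hausdorff_covers \<delta> (f ` A)"
    using bounded_image_nonexpansive[OF lip bd] order.trans[OF diameter_image_le[OF lip bd] d]
    by (auto simp: hausdorff_covers_def)
  ultimately show "\<exists>U\<in>hausdorff_covers \<delta> (f ` A). (\<Sum>i. hausdorff_gauge s (U i)) \<le> ennreal e"
    by (intro bexI[of _ "\<lambda>i. f ` U i"])
qed

text \<open>
  Positivity of \<open>s\<close> matters: sets of diameter 0 have gauge 1 when \<open>s = 0\<close>.
\<close>

lemma hausdorff_null_finite_covers:
  fixes A :: "'a::metric_space set"
  assumes "0 < s"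
    and cov: "\<And>n. finite (F n) \<and> A \<subseteq> \<Union>(F n)"
    and small: "\<And>n B. B \<in> F n \<Longrightarrow> bounded B \<and> diameter B \<le> d n"
    and d: "d \<longlonglongrightarrow> 0" "\<And>n. 0 \<le> d n"
    and sum: "(\<lambda>n. card (F n) * d n powr s) \<longlonglongrightarrow> 0"
  shows "hausdorff_measure s A = 0"
proof (rule hausdorff_nullI)
  fix \<delta> e :: real assume "0 < \<delta>" "0 < e"
  have "eventually (\<lambda>n. d n < \<delta> \<and> card (F n) * d n powr s < e) sequentially"
    using order_tendstoD(2)[OF d(1) \<open>0 < \<delta>\<close>] order_tendstoD(2)[OF sum \<open>0 < e\<close>]
    by (rule eventually_conj)
  then obtain n where n: "d n < \<delta>" "card (F n) * d n powr s < e"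
    unfolding eventually_sequentially by blast
  obtain h where h: "bij_betw h {0..<card (F n)} (F n)"
    using ex_bij_betw_nat_finite cov by blast
  let ?U = "\<lambda>i. if i < card (F n) then h i else {}"
  have hF: "h i \<in> F n" if "i < card (F n)" for i
    using h that by (auto simp: bij_betw_def)
  have hF': "h ` {0..<card (F n)} = F n"
    using h by (simp add: bij_betw_def)
  have "B \<in> range ?U" if "B \<in> F n" for B
  proof -
    obtain i where "i < card (F n)" "B = h i"
      using \<open>B \<in> F n\<close> hF' by (metis atLeastLessThan_iff imageE)
    then have "B = ?U i" by simp
    then show ?thesis by (rule range_eqI)
  qed
  then have "A \<subseteq> (\<Union>i. ?U i)"
    using cov[of n] by blast
  moreover have "bounded (?U i) \<and> diameter (?U i) \<le> \<delta>" for i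
    using small[OF hF, of i] n(1) \<open>0 < \<delta>\<close> by (cases "i < card (F n)") auto
  ultimately have U: "?U \<in> hausdorff_covers \<delta> A"
    unfolding hausdorff_covers_def by blast
  have "hausdorff_gauge s (?U i) \<le> ennreal (d n powr s)" for i
    using small[OF hF] diameter_ge_0[of "h i"] \<open>0 < s\<close>
    by (auto simp: hausdorff_gauge_def intro!: ennreal_leI powr_mono2)
  then have "(\<Sum>i<card (F n). hausdorff_gauge s (?U i)) \<le> (\<Sum>i<card (F n). ennreal (d n powr s))"
    by (intro sum_mono)
  then have "(\<Sum>i. hausdorff_gauge s (?U i)) \<le> (\<Sum>i<card (F n). ennreal (d n powr s))"
    by (subst suminf_finite[of "{..<card (F n)}"]) (auto simp: hausdorff_gauge_def)
  also have "\<dots> = ennreal (card (F n) * d n powr s)"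
    by (simp add: ennreal_mult ennreal_of_nat_eq_real_of_nat)
  also have "\<dots> \<le> ennreal e"
    using n(2) by (intro ennreal_leI) simp
  finally have "(\<Sum>i. hausdorff_gauge s (?U i)) \<le> ennreal e" .
  with U show "\<exists>U\<in>hausdorff_covers \<delta> A. (\<Sum>i. hausdorff_gauge s (U i)) \<le> ennreal e"
    by (intro bexI[of _ ?U])
qed

lemma hausdorff_dim_le:
  "0 \<le> s \<Longrightarrow> hausdorff_measure s A = 0 \<Longrightarrow> hausdorff_dim A \<le> ennreal s"
  unfolding hausdorff_dim_def by (intro INF_lower) simp

lemma hausdorff_dim_ge:
  assumes "\<And>r. 0 \<le> r \<Longrightarrow> r < s \<Longrightarrow> hausdorff_measure r A \<noteq> 0"
  shows "ennreal s \<le> hausdorff_dim A"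
  unfolding hausdorff_dim_def
proof (intro INF_greatest ennreal_leI)
  fix r assume "r \<in> {s. 0 \<le> s \<and> hausdorff_measure s A = 0}"
  then have "0 \<le> r" "hausdorff_measure r A = 0" by auto
  then show "s \<le> r" using assms[of r] by (meson not_le)
qed

lemma hausdorff_dim_le_of_null:
  assumes "\<And>s. 0 \<le> s \<Longrightarrow> hausdorff_measure s B = 0 \<Longrightarrow> hausdorff_measure s A = 0"
  shows "hausdorff_dim A \<le> hausdorff_dim B"
  unfolding hausdorff_dim_def using assms by (intro INF_superset_mono subsetI) simp_all

section \<open>Addresses and the invariant set\<close>

lemma vertex_eq:
  "vertex 0 = vector [2/3, 0]"
  "vertex 1 = vector [-1/3, sqrt 3 / 3]"
  "vertex 2 = vector [-1/3, - sqrt 3 / 3]"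
proof -
  have four: "2 * pi * real 2 / 3 = 2 * (2 * pi / 3)" by simp
  have "cos (2 * pi * real 2 / 3) = -1/2" "sin (2 * pi * real 2 / 3) = - sqrt 3 / 2"
    unfolding four cos_double_cos sin_double cos_120 sin_120 by (simp_all add: power2_eq_square)
  then show "vertex 2 = vector [-1/3, - sqrt 3 / 3]"
    unfolding vertex_def by (simp add: vec_eq_iff forall_2)
  show "vertex 1 = vector [-1/3, sqrt 3 / 3]"
    unfolding vertex_def by (simp add: vec_eq_iff forall_2 cos_120 sin_120)
  show "vertex 0 = vector [2/3, 0]"
    unfolding vertex_def by (simp add: vec_eq_iff forall_2)
qed

lemma vertex_inner:
  assumes "i \<in> {0,1,2}" "j \<in> {0,1,2}"
  shows "vertex i \<bullet> vertex j = (if i = j then 4/9 else - 2/9)"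
  using assms by (auto simp: vertex_eq[simplified] inner_vec_def sum_2)

lemma norm_vertex: "norm (vertex k) = 2/3"
proof -
  define \<theta> where "\<theta> = 2 * pi * real k / 3"
  have "vertex k \<bullet> vertex k = (4/9) * (sin \<theta> * sin \<theta> + cos \<theta> * cos \<theta>)"
    unfolding vertex_def \<theta>_def[symmetric] by (simp add: inner_vec_def sum_2 algebra_simps del: sin_cos_squared_add3)
  also have "\<dots> = (2/3)\<^sup>2"
    using sin_cos_squared_add[of \<theta>] by (simp add: power2_eq_square)
  finally show ?thesis
    by (simp add: norm_eq_sqrt_inner)
qed

definition shift :: "nat \<Rightarrow> (nat \<Rightarrow> 'a) \<Rightarrow> nat \<Rightarrow> 'a" where
  "shift n \<epsilon> = (\<lambda>k. \<epsilon> (k + n))"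

lemma shift_in_address_space: "\<epsilon> \<in> address_space \<Longrightarrow> shift n \<epsilon> \<in> address_space"
  by (simp add: address_space_def shift_def)

lemma address_space_eq: "address_space = (UNIV \<rightarrow>\<^sub>E {0,1,2})"
  by (simp add: address_space_def PiE_UNIV_domain Pi_def)

text \<open>
  Tychonoff, in the product topology of the discrete space of symbols.
\<close>

lemma compact_address_space: "compact address_space"
proof -
  have "compactin (product_topology (\<lambda>i::nat. euclidean) UNIV) (UNIV \<rightarrow>\<^sub>E {0,1,2::nat})"
    by (subst compactin_PiE) (auto intro: finite_imp_compact)
  then show ?thesis
    by (simp add: euclidean_product_topology address_space_eq)
qed

locale contraction_ratio =
  fixes lam :: real
  assumes lam_pos: "0 < lam" and lam_less_1: "lam < 1"
begin

definition digit_term :: "(nat \<Rightarrow> nat) \<Rightarrow> nat \<Rightarrow> real^2" where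
  "digit_term \<epsilon> k = (lam ^ k * (1 - lam)) *\<^sub>R vertex (\<epsilon> k)"

lemma norm_digit_term: "norm (digit_term \<epsilon> k) \<le> lam ^ k * (1 - lam)"
  using lam_pos lam_less_1 by (simp add: digit_term_def norm_vertex abs_mult)

lemma digit_weights_sums: "(\<lambda>k. lam ^ k * (1 - lam)) sums 1"
  using sums_mult2[OF geometric_sums[of lam], of "1 - lam"] lam_pos lam_less_1 by simp

lemma summable_digit_term: "summable (digit_term \<epsilon>)"
  using norm_digit_term
  by (intro summable_comparison_test'[OF sums_summable[OF digit_weights_sums], of 0])

lemma foldr_ifs_map:
  "foldr (\<lambda>k. ifs_map lam (\<epsilon> k)) [0..<n] x = (\<Sum>k<n. digit_term \<epsilon> k) + lam ^ n *\<^sub>R x"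
  by (induction n arbitrary: x) (simp_all add: ifs_map_def digit_term_def algebra_simps)

lemma ifs_iterate_tendsto: "(\<lambda>n. ifs_iterate lam \<epsilon> n x) \<longlonglongrightarrow> (\<Sum>k. digit_term \<epsilon> k)"
proof -
  have "(\<lambda>n. foldr (\<lambda>k. ifs_map lam (\<epsilon> k)) [0..<n] x) \<longlonglongrightarrow> (\<Sum>k. digit_term \<epsilon> k) + 0 *\<^sub>R x"
    unfolding foldr_ifs_map
    using summable_LIMSEQ[OF summable_digit_term] LIMSEQ_realpow_zero lam_pos lam_less_1
    by (intro tendsto_intros) auto
  then show ?thesis
    unfolding ifs_iterate_def using LIMSEQ_Suc by fastforce
qed

lemma address_point_eq: "address_point lam \<epsilon> = (\<Sum>k. digit_term \<epsilon> k)"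
  unfolding address_point_def
proof (rule the_equality)
  show "\<forall>x0. (\<lambda>n. ifs_iterate lam \<epsilon> n x0) \<longlonglongrightarrow> (\<Sum>k. digit_term \<epsilon> k)"
    using ifs_iterate_tendsto by blast
next
  fix x assume "\<forall>x0. (\<lambda>n. ifs_iterate lam \<epsilon> n x0) \<longlonglongrightarrow> x"
  then show "x = (\<Sum>k. digit_term \<epsilon> k)"
    using ifs_iterate_tendsto LIMSEQ_unique by blast
qed

lemma norm_address_point: "norm (address_point lam \<epsilon>) \<le> 1"
proof -
  have "norm (\<Sum>k. digit_term \<epsilon> k) \<le> (\<Sum>k. lam ^ k * (1 - lam))"
    using norm_digit_term digit_weights_sums by (intro norm_suminf_le) (auto simp: sums_iff)
  then show ?thesis using digit_weights_sums by (simp add: address_point_eq sums_iff)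
qed

lemma address_point_split:
  "address_point lam \<epsilon> =
     (\<Sum>k<n. digit_term \<epsilon> k) + lam ^ n *\<^sub>R address_point lam (shift n \<epsilon>)"
proof -
  have "digit_term \<epsilon> (k + n) = lam ^ n *\<^sub>R digit_term (shift n \<epsilon>) k" for k
    by (simp add: digit_term_def shift_def power_add mult_ac)
  then show ?thesis
    using suminf_split_initial_segment[OF summable_digit_term, of \<epsilon> n]
      suminf_scaleR_right[OF summable_digit_term, of "lam ^ n" "shift n \<epsilon>"]
    by (simp add: address_point_eq add.commute)
qed

lemma address_point_prefix:
  "address_point lam \<epsilon> = foldr (\<lambda>k. ifs_map lam (\<epsilon> k)) [0..<n] (address_point lam (shift n \<epsilon>))"
  unfolding foldr_ifs_map by (rule address_point_split)

lemma address_point_Suc: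
  "address_point lam \<epsilon> = ifs_map lam (\<epsilon> 0) (address_point lam (shift 1 \<epsilon>))"
  using address_point_prefix[of \<epsilon> 1] by simp

lemma norm_address_point_diff:
  assumes "\<And>k. k < n \<Longrightarrow> \<epsilon> k = \<eta> k"
  shows "norm (address_point lam \<epsilon> - address_point lam \<eta>) \<le> 2 * lam ^ n"
proof -
  have "(\<Sum>k<n. digit_term \<epsilon> k) = (\<Sum>k<n. digit_term \<eta> k)"
    using assms by (intro sum.cong) (auto simp: digit_term_def)
  then have "address_point lam \<epsilon> - address_point lam \<eta> =
      lam ^ n *\<^sub>R (address_point lam (shift n \<epsilon>) - address_point lam (shift n \<eta>))"
    using address_point_split[of \<epsilon> n] address_point_split[of \<eta> n] by (simp add: scaleR_diff_right)
  moreover have "norm (address_point lam (shift n \<epsilon>) - address_point lam (shift n \<eta>)) \<le> 1 + 1"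
    using norm_address_point by (intro order.trans[OF norm_triangle_ineq4] add_mono)
  ultimately show ?thesis
    using lam_pos by (simp add: mult.commute)
qed

lemma continuous_on_address_point: "continuous_on UNIV (address_point lam)"
proof -
  have "uniform_limit UNIV (\<lambda>n \<epsilon>. \<Sum>k<n. digit_term \<epsilon> k) (\<lambda>\<epsilon>. \<Sum>k. digit_term \<epsilon> k) sequentially"
    by (rule Weierstrass_m_test[OF norm_digit_term sums_summable[OF digit_weights_sums]])
  moreover have "continuous_on UNIV (\<lambda>\<epsilon>. digit_term \<epsilon> k)" for k
    unfolding digit_term_def
  proof (intro continuous_on_scaleR continuous_on_const)
    have "continuous_on UNIV vertex" by simp
    then show "continuous_on UNIV (\<lambda>\<epsilon>. vertex (\<epsilon> k))"
      by (rule continuous_on_compose2[OF _ continuous_on_product_coordinates]) simp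
  qed
  then have "continuous_on UNIV (\<lambda>\<epsilon>. \<Sum>k<n. digit_term \<epsilon> k)" for n
    by (intro continuous_on_sum) auto
  ultimately have "continuous_on UNIV (\<lambda>\<epsilon>. \<Sum>k. digit_term \<epsilon> k)"
    by (intro uniform_limit_theorem[where F = sequentially]) auto
  then show ?thesis by (simp add: address_point_eq[abs_def])
qed

lemma image_address_point_invariant:
  "address_point lam ` address_space =
     (\<Union>i\<in>{0,1,2}. ifs_map lam i ` address_point lam ` address_space)"
proof (intro equalityI subsetI)
  fix x assume "x \<in> address_point lam ` address_space"
  then obtain \<epsilon> where e: "\<epsilon> \<in> address_space" "x = address_point lam \<epsilon>" by blast
  then have "x = ifs_map lam (\<epsilon> 0) (address_point lam (shift 1 \<epsilon>))"
    using address_point_Suc[of \<epsilon>] by (simp only:)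
  moreover have "\<epsilon> 0 \<in> {0,1,2}" using e(1) by (simp add: address_space_def)
  ultimately show "x \<in> (\<Union>i\<in>{0,1,2}. ifs_map lam i ` address_point lam ` address_space)"
    using shift_in_address_space[OF e(1)] by blast
next
  fix x assume "x \<in> (\<Union>i\<in>{0,1,2}. ifs_map lam i ` address_point lam ` address_space)"
  then obtain i \<epsilon> where e: "i \<in> {0,1,2}" "\<epsilon> \<in> address_space"
    "x = ifs_map lam i (address_point lam \<epsilon>)" by blast
  let ?\<eta> = "case_nat i \<epsilon>"
  have "?\<eta> \<in> address_space" using e by (auto simp: address_space_def split: nat.split)
  moreover have "shift 1 ?\<eta> = \<epsilon>" by (simp add: shift_def)
  then have "x = address_point lam ?\<eta>"
    using address_point_Suc[of ?\<eta>] e(3) by simp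
  ultimately show "x \<in> address_point lam ` address_space" by blast
qed

text \<open>
  Following preimages inside an invariant set produces an address. This gives uniqueness of the
  compact invariant set, since bounded remainders are contracted away.
\<close>

lemma address_of_invariant_point:
  assumes inv: "T = (\<Union>i\<in>{0,1,2}. ifs_map lam i ` T)" and "x \<in> T"
  obtains \<epsilon> y where "\<epsilon> \<in> address_space" "\<And>n. y n \<in> T"
    "\<And>n. x = foldr (\<lambda>k. ifs_map lam (\<epsilon> k)) [0..<n] (y n)"
proof -
  have "\<forall>x\<in>T. \<exists>p. fst p \<in> {0,1,2} \<and> snd p \<in> T \<and> x = ifs_map lam (fst p) (snd p)"
  proof
    fix x assume "x \<in> T"
    then obtain i z where "i \<in> {0,1,2}" "z \<in> T" "x = ifs_map lam i z" using inv by blast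
    then show "\<exists>p. fst p \<in> {0,1,2} \<and> snd p \<in> T \<and> x = ifs_map lam (fst p) (snd p)"
      by (intro exI[of _ "(i, z)"]) simp
  qed
  then obtain p where p: "\<And>x. x \<in> T \<Longrightarrow> fst (p x) \<in> {0,1,2} \<and> snd (p x) \<in> T \<and>
      x = ifs_map lam (fst (p x)) (snd (p x))" by metis
  define y where "y n = ((snd \<circ> p) ^^ n) x" for n
  have y: "y n \<in> T" for n
    by (induction n) (use p \<open>x \<in> T\<close> in \<open>simp_all add: y_def\<close>)
  have ySuc: "y (Suc n) = snd (p (y n))" for n by (simp add: y_def)
  show ?thesis
  proof (rule that[of "\<lambda>n. fst (p (y n))" y])
    show "(\<lambda>n. fst (p (y n))) \<in> address_space"
      unfolding address_space_def using p y by blast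
    show "x = foldr (\<lambda>k. ifs_map lam (fst (p (y k)))) [0..<n] (y n)" for n
    proof (induction n)
      case (Suc n)
      have "ifs_map lam (fst (p (y n))) (y (Suc n)) = y n"
        using p[OF y] ySuc by metis
      with Suc show ?case by simp
    qed (simp add: y_def)
  qed (rule y)
qed

lemma invariant_set_eq: "invariant_set lam = address_point lam ` address_space"
  unfolding invariant_set_def
proof (rule the_equality)
  have "compact (address_point lam ` address_space)"
    using continuous_on_subset[OF continuous_on_address_point] compact_address_space
    by (intro compact_continuous_image) auto
  moreover have "(\<lambda>_. 0) \<in> address_space" by (simp add: address_space_def)
  ultimately show "address_point lam ` address_space \<noteq> {} \<and> compact (address_point lam ` address_space) \<and>
     address_point lam ` address_space = (\<Union>i\<in>{0,1,2}. ifs_map lam i ` address_point lam ` address_space)"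
    using image_address_point_invariant by blast
next
  fix T assume T: "T \<noteq> {} \<and> compact T \<and> T = (\<Union>i\<in>{0,1,2}. ifs_map lam i ` T)"
  show "T = address_point lam ` address_space"
  proof (intro equalityI subsetI)
    fix x assume "x \<in> T"
    obtain \<epsilon> y where e: "\<epsilon> \<in> address_space" "\<And>n. y n \<in> T"
      "\<And>n. x = foldr (\<lambda>k. ifs_map lam (\<epsilon> k)) [0..<n] (y n)"
      using address_of_invariant_point[of T x] T \<open>x \<in> T\<close> by metis
    obtain B where B: "\<And>z. z \<in> T \<Longrightarrow> norm z \<le> B"
      using T compact_imp_bounded bounded_iff by metis
    have "(\<lambda>n. lam ^ n *\<^sub>R y n) \<longlonglongrightarrow> 0"
    proof (rule Lim_null_comparison)
      show "\<forall>\<^sub>F n in sequentially. norm (lam ^ n *\<^sub>R y n) \<le> lam ^ n * B"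
        using B e(2) lam_pos by (auto simp: mult_left_mono)
      show "(\<lambda>n. lam ^ n * B) \<longlonglongrightarrow> 0"
        using LIMSEQ_realpow_zero lam_pos lam_less_1 by (intro tendsto_mult_left_zero) auto
    qed
    from tendsto_add[OF summable_LIMSEQ[OF summable_digit_term] this, of \<epsilon>]
    have "(\<lambda>n. x) \<longlonglongrightarrow> address_point lam \<epsilon>"
      using e(3) by (simp add: foldr_ifs_map address_point_eq flip: e(3))
    then have "x = address_point lam \<epsilon>" by (simp add: LIMSEQ_const_iff)
    then show "x \<in> address_point lam ` address_space" using e(1) by blast
  next
    fix x assume "x \<in> address_point lam ` address_space"
    then obtain \<epsilon> where e: "\<epsilon> \<in> address_space" "x = address_point lam \<epsilon>" by blast
    obtain z where "z \<in> T" using T by blast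
    have sub: "ifs_map lam i y \<in> T" if "y \<in> T" "i \<in> {0,1,2}" for i y
      using that T by blast
    have "foldr (\<lambda>k. ifs_map lam (\<epsilon> k)) [0..<n] y \<in> T" if "y \<in> T" for n y
      using that
    proof (induction n arbitrary: y)
      case (Suc n)
      have "\<epsilon> n \<in> {0,1,2}" using e(1) by (simp add: address_space_def)
      with Suc sub show ?case by simp
    qed simp
    then have "ifs_iterate lam \<epsilon> n z \<in> T" for n
      using \<open>z \<in> T\<close> unfolding ifs_iterate_def by blast
    moreover have "closed T" using T compact_imp_closed by blast
    ultimately show "x \<in> T"
      using closed_sequentially ifs_iterate_tendsto e(2) address_point_eq by metis
  qed
qed

lemma compact_invariant_set: "compact (invariant_set lam)"
  using continuous_on_subset[OF continuous_on_address_point] compact_address_space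
  by (subst invariant_set_eq, intro compact_continuous_image) auto

lemma ifs_map_invariant_set:
  "i \<in> {0,1,2} \<Longrightarrow> x \<in> invariant_set lam \<Longrightarrow> ifs_map lam i x \<in> invariant_set lam"
  using image_address_point_invariant unfolding invariant_set_eq by blast

end

section \<open>Points with fewer than continuum many addresses\<close>

text \<open>
  A Cantor scheme. A subset \<open>A\<close> of the naturals steers an infinite path through pairs of a sequence in
  \<open>T\<close> and a length up to which it is final: at stage \<open>k\<close> the sequence is replaced by one that
  branches off later if \<open>k \<in> A\<close> and kept otherwise, and in both cases the final part is extended
  past the branching index. Limits of paths stay in \<open>T\<close>, and different subsets part at the first
  stage at which they differ.
\<close>

lemma continuum_lepoll_perfect:
  fixes T :: "(nat \<Rightarrow> 'a) set"
  assumes "\<epsilon>\<^sub>0 \<in> T"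
    and perfect: "\<And>\<epsilon> n. \<epsilon> \<in> T \<Longrightarrow> \<exists>\<epsilon>'\<in>T. \<epsilon>' \<noteq> \<epsilon> \<and> (\<forall>k<n. \<epsilon>' k = \<epsilon> k)"
    and closed: "\<And>\<eta>. (\<And>n. \<exists>\<epsilon>\<in>T. \<forall>k<n. \<epsilon> k = \<eta> k) \<Longrightarrow> \<eta> \<in> T"
  shows "(UNIV :: nat set set) \<lesssim> T"
proof -
  obtain alt where alt: "\<And>\<epsilon> n. \<epsilon> \<in> T \<Longrightarrow>
      alt \<epsilon> n \<in> T \<and> alt \<epsilon> n \<noteq> \<epsilon> \<and> (\<forall>k<n. alt \<epsilon> n k = \<epsilon> k)"
    using perfect by metis
  define d where "d \<epsilon> n = (LEAST k. alt \<epsilon> n k \<noteq> \<epsilon> k)" for \<epsilon> n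
  have d: "alt \<epsilon> n (d \<epsilon> n) \<noteq> \<epsilon> (d \<epsilon> n)" "n \<le> d \<epsilon> n" if "\<epsilon> \<in> T" for \<epsilon> n
  proof -
    have "\<exists>k. alt \<epsilon> n k \<noteq> \<epsilon> k" using alt[OF that] by blast
    then show "alt \<epsilon> n (d \<epsilon> n) \<noteq> \<epsilon> (d \<epsilon> n)"
      unfolding d_def by (rule LeastI_ex)
    then show "n \<le> d \<epsilon> n" using alt[OF that] by (meson not_le)
  qed
  define st where "st A = rec_nat (\<epsilon>\<^sub>0, 0)
      (\<lambda>k p. (if k \<in> A then alt (fst p) (snd p) else fst p, Suc (d (fst p) (snd p))))" for A
  define e where "e A k = fst (st A k)" for A k
  define l where "l A k = snd (st A k)" for A k
  have e_Suc: "e A (Suc k) = (if k \<in> A then alt (e A k) (l A k) else e A k)"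
    and l_Suc: "l A (Suc k) = Suc (d (e A k) (l A k))" for A k
    by (simp_all add: e_def l_def st_def)
  have eT: "e A k \<in> T" for A k
    by (induction k) (use \<open>\<epsilon>\<^sub>0 \<in> T\<close> alt in \<open>simp_all add: e_Suc, simp add: e_def st_def\<close>)
  have l_less: "l A k < l A (Suc k)" for A k
    using d(2)[OF eT, of "l A k" A k] by (simp add: l_Suc)
  have l_mono: "l A k \<le> l A j" if "k \<le> j" for A k j
    using that l_less[of A] by (metis lift_Suc_mono_le less_imp_le)
  have l_ge: "k \<le> l A k" for A k
  proof (induction k)
    case (Suc k)
    then show ?case using l_less[of A k] by simp
  qed simp
  have e_stable: "e A j i = e A k i" if "k \<le> j" "i < l A k" for A i j k
    using that(1)
  proof (induction j rule: dec_induct)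
    case (step j)
    have "i < l A j" using l_mono[OF step(1)] that(2) by (rule less_le_trans[rotated])
    then have "e A (Suc j) i = e A j i"
      using alt[OF eT] by (simp add: e_Suc)
    with step show ?case by simp
  qed simp
  define \<eta> where "\<eta> A i = e A (Suc i) i" for A i
  have \<eta>_eq: "\<eta> A i = e A k i" if "i < l A k" for A i k
  proof (cases "k \<le> Suc i")
    case True
    then show ?thesis using e_stable that by (simp add: \<eta>_def)
  next
    case False
    moreover have "i < l A (Suc i)" using l_ge[of "Suc i" A] by simp
    ultimately show ?thesis using e_stable[of "Suc i" k i A] by (simp add: \<eta>_def)
  qed
  have "\<eta> A \<in> T" for A
  proof (rule closed)
    fix n
    have "\<eta> A k = e A n k" if "k < n" for k
      using that l_ge[of n A] by (intro \<eta>_eq) simp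
    then show "\<exists>\<epsilon>\<in>T. \<forall>k<n. \<epsilon> k = \<eta> A k" using eT by metis
  qed
  moreover have "inj \<eta>"
  proof (rule injI, rule ccontr)
    fix A B assume eq: "\<eta> A = \<eta> B" and "A \<noteq> B"
    then have ex: "\<exists>k. (k \<in> A) \<noteq> (k \<in> B)" by blast
    define k where "k = (LEAST k. (k \<in> A) \<noteq> (k \<in> B))"
    have k: "(k \<in> A) \<noteq> (k \<in> B)" unfolding k_def using ex by (rule LeastI_ex)
    have below: "i \<in> A \<longleftrightarrow> i \<in> B" if "i < k" for i
      using not_less_Least[OF that[unfolded k_def]] by blast
    have "st A j = st B j" if "j \<le> k" for j
      using that
    proof (induction j)
      case (Suc j)
      then have "st A j = st B j" "j \<in> A \<longleftrightarrow> j \<in> B" using below by auto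
      then show ?case by (simp add: st_def)
    qed (simp add: st_def)
    then have AB: "e A k = e B k" "l A k = l B k" by (simp_all add: e_def l_def)
    let ?i = "d (e A k) (l A k)"
    have "\<eta> A ?i = e A (Suc k) ?i" by (intro \<eta>_eq) (simp add: l_Suc)
    moreover have "\<eta> B ?i = e B (Suc k) ?i" by (intro \<eta>_eq) (simp add: l_Suc AB)
    moreover have "alt (e A k) (l A k) ?i \<noteq> e A k ?i" using d(1)[OF eT] .
    ultimately show False using eq k AB by (auto simp: e_Suc split: if_splits)
  qed
  ultimately show ?thesis unfolding lepoll_def by blast
qed

context contraction_ratio
begin

lemma uniqueness_subset_less_than_continuum:
  "uniqueness_set lam \<subseteq> less_than_continuum_set lam"
proof
  fix x assume "x \<in> uniqueness_set lam"
  then obtain \<epsilon> where "x \<in> invariant_set lam" "addresses lam x = {\<epsilon>}"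
    unfolding uniqueness_set_def by auto
  moreover have "infinite (UNIV :: nat set set)" by (simp add: Finite_Set.finite_set)
  ultimately show "x \<in> less_than_continuum_set lam"
    by (simp add: less_than_continuum_set_def finite_lesspoll_infinite)
qed

lemma addresses_closed:
  assumes "\<And>n. \<exists>\<epsilon>\<in>addresses lam x. \<forall>k<n. \<epsilon> k = \<eta> k"
  shows "\<eta> \<in> addresses lam x"
proof -
  have "\<eta> n \<in> {0,1,2}" for n
  proof -
    obtain \<epsilon> where "\<epsilon> \<in> addresses lam x" "\<epsilon> n = \<eta> n" using assms[of "Suc n"] by auto
    then show ?thesis unfolding addresses_def address_space_def by (metis (no_types, lifting) mem_Collect_eq)
  qed
  moreover have "norm (x - address_point lam \<eta>) \<le> 2 * lam ^ n" for n
  proof -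
    obtain \<epsilon> where "\<epsilon> \<in> addresses lam x" "\<forall>k<n. \<epsilon> k = \<eta> k" using assms[of n] by blast
    then show ?thesis
      using norm_address_point_diff[of n \<epsilon> \<eta>] by (simp add: addresses_def)
  qed
  moreover have "(\<lambda>n. 2 * lam ^ n) \<longlonglongrightarrow> 0"
    using LIMSEQ_realpow_zero lam_pos lam_less_1 by (intro tendsto_mult_right_zero) auto
  ultimately have "norm (x - address_point lam \<eta>) \<le> 0"
    by (metis (no_types, lifting) LIMSEQ_le_const)
  with \<open>\<And>n. \<eta> n \<in> {0,1,2}\<close> show ?thesis by (simp add: addresses_def address_space_def)
qed

text \<open>
  If no tail of an address of \<open>x\<close> is the unique address of its point, every tail can be exchanged for
  another address of the same point. So the set of addresses of \<open>x\<close> is perfect and has the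
  cardinality of the continuum.
\<close>

lemma less_than_continuum_subset:
  "less_than_continuum_set lam \<subseteq> (\<Union>w::nat list. foldr (ifs_map lam) w ` uniqueness_set lam)"
proof (rule subsetI, rule ccontr)
  fix x assume x: "x \<in> less_than_continuum_set lam"
    and notin: "x \<notin> (\<Union>w::nat list. foldr (ifs_map lam) w ` uniqueness_set lam)"
  have tail: "address_point lam (shift n \<epsilon>) \<notin> uniqueness_set lam"
    if "\<epsilon> \<in> addresses lam x" for \<epsilon> n
  proof
    assume "address_point lam (shift n \<epsilon>) \<in> uniqueness_set lam"
    moreover have "x = foldr (ifs_map lam) (map \<epsilon> [0..<n]) (address_point lam (shift n \<epsilon>))"
      using that address_point_prefix[of \<epsilon> n] by (simp add: addresses_def foldr_map comp_def)
    ultimately show False using notin by blast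
  qed
  have "x \<in> invariant_set lam" using x by (simp add: less_than_continuum_set_def)
  then obtain \<epsilon>\<^sub>0 where "\<epsilon>\<^sub>0 \<in> addresses lam x" by (auto simp: invariant_set_eq addresses_def)
  then have "(UNIV :: nat set set) \<lesssim> addresses lam x"
  proof (rule continuum_lepoll_perfect)
    fix \<epsilon> n assume e: "\<epsilon> \<in> addresses lam x"
    then have "shift n \<epsilon> \<in> address_space"
      using shift_in_address_space by (simp add: addresses_def)
    then have "address_point lam (shift n \<epsilon>) \<in> invariant_set lam"
      "shift n \<epsilon> \<in> addresses lam (address_point lam (shift n \<epsilon>))"
      by (simp_all add: invariant_set_eq addresses_def)
    with tail[OF e, of n] obtain \<eta>
      where \<eta>: "\<eta> \<in> addresses lam (address_point lam (shift n \<epsilon>))" "\<eta> \<noteq> shift n \<epsilon>"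
      unfolding uniqueness_set_def by blast
    define \<epsilon>' where "\<epsilon>' k = (if k < n then \<epsilon> k else \<eta> (k - n))" for k
    have sh: "shift n \<epsilon>' = \<eta>" by (simp add: \<epsilon>'_def shift_def)
    have "(\<Sum>k<n. digit_term \<epsilon>' k) = (\<Sum>k<n. digit_term \<epsilon> k)"
      by (intro sum.cong) (auto simp: digit_term_def \<epsilon>'_def)
    then have "address_point lam \<epsilon>' = address_point lam \<epsilon>"
      using address_point_split[of \<epsilon> n] address_point_split[of \<epsilon>' n] \<eta>(1) sh
      by (simp add: addresses_def)
    moreover have "\<epsilon>' \<in> address_space"
      using e \<eta>(1) unfolding addresses_def address_space_def \<epsilon>'_def by simp
    ultimately have "\<epsilon>' \<in> addresses lam x"
      using e by (simp add: addresses_def)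
    moreover have "\<epsilon>' \<noteq> \<epsilon>" using sh \<eta>(2) by blast
    ultimately show "\<exists>\<epsilon>'\<in>addresses lam x. \<epsilon>' \<noteq> \<epsilon> \<and> (\<forall>k<n. \<epsilon>' k = \<epsilon> k)"
      by (intro bexI[of _ \<epsilon>']) (auto simp: \<epsilon>'_def)
  qed (rule addresses_closed)
  with x show False
    unfolding less_than_continuum_set_def lesspoll_def using lepoll_antisym by blast
qed

lemma dist_foldr_ifs_map:
  "dist (foldr (ifs_map lam) w x) (foldr (ifs_map lam) w y) = lam ^ length w * dist x y"
proof (induction w)
  case (Cons i w)
  have "dist (ifs_map lam i u) (ifs_map lam i v) = lam * dist u v" for u v
    using lam_pos by (simp add: ifs_map_def dist_norm flip: scaleR_diff_right)
  with Cons show ?case by simp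
qed simp

lemma hausdorff_dim_less_than_continuum_eq:
  "hausdorff_dim (less_than_continuum_set lam) = hausdorff_dim (uniqueness_set lam)"
proof (rule antisym; rule hausdorff_dim_le_of_null)
  fix s :: real
  assume "hausdorff_measure s (less_than_continuum_set lam) = 0"
  then show "hausdorff_measure s (uniqueness_set lam) = 0"
    using hausdorff_null_mono uniqueness_subset_less_than_continuum by blast
next
  fix s :: real
  assume s: "0 \<le> s" "hausdorff_measure s (uniqueness_set lam) = 0"
  have "lam ^ n * r \<le> r" if "0 \<le> r" for n r
    using that lam_pos lam_less_1 by (simp add: mult_left_le_one_le power_le_one)
  then have "hausdorff_measure s (foldr (ifs_map lam) w ` uniqueness_set lam) = 0" for w
    using s by (intro hausdorff_null_image) (auto simp: dist_foldr_ifs_map)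
  then have "hausdorff_measure s (\<Union>n. foldr (ifs_map lam) (from_nat n) ` uniqueness_set lam) = 0"
    by (intro hausdorff_null_UN)
  moreover have "(\<Union>w::nat list. foldr (ifs_map lam) w ` uniqueness_set lam)
      \<subseteq> (\<Union>n. foldr (ifs_map lam) (from_nat n) ` uniqueness_set lam)"
  proof (intro UN_least)
    fix w :: "nat list"
    have "foldr (ifs_map lam) w ` uniqueness_set lam
        = foldr (ifs_map lam) (from_nat (to_nat w)) ` uniqueness_set lam" by simp
    then show "foldr (ifs_map lam) w ` uniqueness_set lam
        \<subseteq> (\<Union>n. foldr (ifs_map lam) (from_nat n) ` uniqueness_set lam)" by blast
  qed
  ultimately show "hausdorff_measure s (less_than_continuum_set lam) = 0"
    using less_than_continuum_subset hausdorff_null_mono by (meson subset_trans)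
qed

end

section \<open>Uniqueness at multinacci ratios\<close>

locale multinacci_ratio = contraction_ratio lam for lam :: real +
  fixes m :: nat
  assumes m_ge_2: "2 \<le> m" and multinacci_sum: "(\<Sum>k=1..m. lam ^ k) = 1"
begin

lemma multinacci_eq: "lam * (1 - lam ^ m) = 1 - lam"
proof -
  have "(1 - lam) * (\<Sum>k=1..m. lam ^ k) = lam - lam ^ Suc m"
    using sum_gp_multiplied[of 1 m lam] m_ge_2 by simp
  then show ?thesis unfolding multinacci_sum by (simp add: algebra_simps)
qed

lemma sum_first_two_le: "lam + lam ^ 2 \<le> 1"
proof -
  have "(\<Sum>k\<in>{1,2}. lam ^ k) \<le> (\<Sum>k=1..m. lam ^ k)"
    using m_ge_2 lam_pos by (intro sum_mono2) auto
  then show ?thesis unfolding multinacci_sum by simp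
qed

lemma ratio_le_two_thirds: "3 * lam \<le> 2"
proof (rule ccontr)
  assume "\<not> 3 * lam \<le> 2"
  then have "2/3 < lam" by simp
  then have "(2/3) ^ 2 < lam ^ 2" by (intro power_strict_mono) auto
  with \<open>2/3 < lam\<close> show False using sum_first_two_le by (simp add: power2_eq_square)
qed

lemma power_bounds: "0 \<le> lam ^ n" "lam ^ n \<le> 1"
  using lam_pos lam_less_1 by (simp_all add: power_le_one)

text \<open>
  The identity \<open>f\<^sub>i f\<^sub>j^m = f\<^sub>j f\<^sub>i^m\<close>, visible in the symmetry of the right-hand side: the \<open>m\<close> later
  digits carry total weight \<open>\<lambda> + \<dots> + \<lambda>^m = 1\<close>, the same as the first digit.
\<close>

lemma address_point_block:
  assumes "\<epsilon> 0 = i" "\<And>k. k \<in> {1..m} \<Longrightarrow> \<epsilon> k = j"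
  shows "address_point lam \<epsilon> =
    (1 - lam) *\<^sub>R (vertex i + vertex j) + lam ^ Suc m *\<^sub>R address_point lam (shift (Suc m) \<epsilon>)"
proof -
  have "(\<Sum>k<Suc m. digit_term \<epsilon> k) = digit_term \<epsilon> 0 + (\<Sum>k=1..m. digit_term \<epsilon> k)"
    by (simp add: lessThan_Suc_atMost atMost_atLeast0 sum.atLeast_Suc_atMost)
  also have "(\<Sum>k=1..m. digit_term \<epsilon> k) = (\<Sum>k=1..m. lam ^ k *\<^sub>R ((1 - lam) *\<^sub>R vertex j))"
    using assms(2) by (intro sum.cong) (auto simp: digit_term_def)
  also have "\<dots> = (1 - lam) *\<^sub>R vertex j"
    by (subst scaleR_sum_left[symmetric]) (simp only: multinacci_sum scaleR_one)
  finally show ?thesis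
    using address_point_split[of \<epsilon> "Suc m"] assms(1) by (simp add: digit_term_def scaleR_add_right)
qed

lemma address_point_swap:
  assumes "\<epsilon> n = i" "\<And>k. k \<in> {1..m} \<Longrightarrow> \<epsilon> (n + k) = j"
  shows "address_point lam (\<lambda>k. if k = n then j else if k \<in> {n+1..n+m} then i else \<epsilon> k)
       = address_point lam \<epsilon>"
    (is "address_point lam ?\<eta> = _")
proof -
  have "address_point lam (shift n ?\<eta>) =
      (1 - lam) *\<^sub>R (vertex j + vertex i) + lam ^ Suc m *\<^sub>R address_point lam (shift (Suc m) (shift n ?\<eta>))"
    by (rule address_point_block) (auto simp: shift_def)
  moreover have "address_point lam (shift n \<epsilon>) =
      (1 - lam) *\<^sub>R (vertex i + vertex j) + lam ^ Suc m *\<^sub>R address_point lam (shift (Suc m) (shift n \<epsilon>))"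
    using assms by (intro address_point_block) (auto simp: shift_def add.commute)
  moreover have "shift (Suc m) (shift n ?\<eta>) = shift (Suc m) (shift n \<epsilon>)"
    by (auto simp: shift_def)
  ultimately have "address_point lam (shift n ?\<eta>) = address_point lam (shift n \<epsilon>)"
    by (simp add: add.commute)
  moreover have "(\<Sum>k<n. digit_term ?\<eta> k) = (\<Sum>k<n. digit_term \<epsilon> k)"
    by (intro sum.cong) (auto simp: digit_term_def)
  ultimately show ?thesis
    using address_point_split[of \<epsilon> n] address_point_split[of ?\<eta> n] by (simp only:)
qed

lemma unique_address_avoids:
  assumes "address_point lam \<epsilon> \<in> uniqueness_set lam" "\<epsilon> \<in> address_space"
    and "\<And>k. k \<in> {1..m} \<Longrightarrow> \<epsilon> (n + k) = j"
  shows "\<epsilon> n = j"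
proof (rule ccontr)
  assume ne: "\<epsilon> n \<noteq> j"
  let ?\<eta> = "\<lambda>k. if k = n then j else if k \<in> {n+1..n+m} then \<epsilon> n else \<epsilon> k"
  have "address_point lam ?\<eta> = address_point lam \<epsilon>"
    using assms(3) by (rule address_point_swap[OF refl])
  moreover have "j = \<epsilon> (n + 1)" using assms(3)[of 1] m_ge_2 by simp
  then have "?\<eta> \<in> address_space" using assms(2) unfolding address_space_def by simp
  ultimately have "?\<eta> \<in> addresses lam (address_point lam \<epsilon>)"
    "\<epsilon> \<in> addresses lam (address_point lam \<epsilon>)"
    using assms(2) by (simp_all add: addresses_def)
  then have "?\<eta> = \<epsilon>" using assms(1) unfolding uniqueness_set_def by blast
  then have "?\<eta> n = \<epsilon> n" by (rule fun_cong)
  with ne show False by simp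
qed

end

section \<open>Upper bound for the uniqueness set\<close>

text \<open>
  Only runs preceded by a different symbol are limited to length below \<open>m\<close>. The initial run of a word
  may have any length.
\<close>

definition run_limited_words :: "nat \<Rightarrow> nat \<Rightarrow> nat list set" where
  "run_limited_words m n = {w. length w = n \<and> set w \<subseteq> {0,1,2} \<and>
     (\<forall>u i j v. w = u @ [i] @ replicate m j @ v \<longrightarrow> i = j)}"

lemma finite_run_limited_words: "finite (run_limited_words m n)"
  by (rule finite_subset[OF _ finite_lists_length_eq[of "{0,1,2::nat}" n]])
     (auto simp: run_limited_words_def)

lemma run_limited_words_decomp:
  assumes "w \<in> run_limited_words m n"
  shows "w \<in> (\<lambda>j. replicate n j) ` {0,1,2} \<or>
     (\<exists>r\<in>{1..<m}. r < n \<and> (\<exists>u\<in>run_limited_words m (n - r). \<exists>j\<in>{0,1,2} - {last u}.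
        w = u @ replicate r j))"
proof (cases "n = 0")
  case True
  then show ?thesis using assms by (simp add: run_limited_words_def)
next
  case False
  define j where "j = last w"
  have w: "length w = n" "set w \<subseteq> {0,1,2}" using assms by (auto simp: run_limited_words_def)
  have "w \<noteq> []" using w(1) False by auto
  then have j: "j \<in> {0,1,2}" using w(2) unfolding j_def using last_in_set by blast
  define r where "r = length (takeWhile ((=) j) (rev w))"
  define u where "u = rev (dropWhile ((=) j) (rev w))"
  have take: "takeWhile ((=) j) (rev w) = replicate r j"
    unfolding r_def by (rule replicate_length_same[symmetric]) (auto dest: set_takeWhileD)
  have "rev w = replicate r j @ rev u"
    using takeWhile_dropWhile_id[of "(=) j" "rev w"] unfolding take u_def by simp
  then have wu: "w = u @ replicate r j"
    using rev_rev_ident[of w] by simp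
  have "r \<noteq> 0"
    unfolding r_def j_def using \<open>w \<noteq> []\<close> by (cases w rule: rev_cases) auto
  show ?thesis
  proof (cases "u = []")
    case True
    then have "w = replicate n j" using wu w(1) by simp
    then show ?thesis using j by blast
  next
    case nonempty: False
    have "hd (rev u) \<noteq> j"
      using nonempty hd_dropWhile[of "(=) j" "rev w"] unfolding u_def by auto
    then have last: "last u \<noteq> j" by (simp add: hd_rev)
    have "r < m"
    proof (rule ccontr)
      assume "\<not> r < m"
      then have "replicate r j = replicate m j @ replicate (r - m) j"
        by (simp flip: replicate_add)
      then have "w = butlast u @ [last u] @ replicate m j @ replicate (r - m) j"
        using wu nonempty by simp
      then show False using assms last unfolding run_limited_words_def by blast
    qed
    moreover have "u \<in> run_limited_words m (n - r)"
    proof -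
      have "length u = n - r" "set u \<subseteq> {0,1,2}" using w wu by auto
      moreover have "i = k" if "u = a @ [i] @ replicate m k @ b" for a i k b
      proof -
        have "w = a @ [i] @ replicate m k @ (b @ replicate r j)" using wu that by simp
        then show ?thesis using assms unfolding run_limited_words_def by blast
      qed
      ultimately show ?thesis unfolding run_limited_words_def by blast
    qed
    moreover have "r < n" using w(1) wu nonempty by auto
    ultimately show ?thesis using \<open>r \<noteq> 0\<close> last j wu by (intro disjI2 bexI[of _ r]) auto
  qed
qed

text \<open>
  Split off the last run. Either it is the whole word, or it has length \<open>r < m\<close>, and its symbol is one
  of the two that differ from the symbol before it.
\<close>

lemma card_run_limited_words_le:
  "card (run_limited_words m n) \<le> 3 + (\<Sum>r\<in>{r\<in>{1..<m}. r < n}. 2 * card (run_limited_words m (n - r)))"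
proof -
  let ?R = "{r\<in>{1..<m}. r < n}"
  let ?A = "\<lambda>r. (\<lambda>(u, j). u @ replicate r j) `
      (SIGMA u:run_limited_words m (n - r). {0,1,2} - {last u})"
  have fin: "finite (SIGMA u:run_limited_words m (n - r). {0,1,2} - {last u})" for r
    using finite_run_limited_words by (intro finite_SigmaI) auto
  have "run_limited_words m n \<subseteq> (\<lambda>j. replicate n j) ` {0,1,2} \<union> (\<Union>r\<in>?R. ?A r)"
    using run_limited_words_decomp[of _ m n] by fastforce
  then have "card (run_limited_words m n) \<le> card ((\<lambda>j. replicate n j) ` {0,1,2::nat} \<union> (\<Union>r\<in>?R. ?A r))"
    using fin by (intro card_mono) auto
  also have "\<dots> \<le> card ((\<lambda>j. replicate n j) ` {0,1,2::nat}) + card (\<Union>r\<in>?R. ?A r)"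
    by (rule card_Un_le)
  also have "\<dots> \<le> 3 + (\<Sum>r\<in>?R. 2 * card (run_limited_words m (n - r)))"
  proof (rule add_mono)
    show "card ((\<lambda>j. replicate n j) ` {0,1,2::nat}) \<le> 3"
      using card_image_le[of "{0,1,2::nat}" "\<lambda>j. replicate n j"] by simp
    have "card (?A r) \<le> 2 * card (run_limited_words m (n - r))" if "r \<in> ?R" for r
    proof -
      have "card (?A r) \<le> card (SIGMA u:run_limited_words m (n - r). {0,1,2} - {last u})"
        using fin by (rule card_image_le)
      also have "\<dots> = (\<Sum>u\<in>run_limited_words m (n - r). card ({0,1,2} - {last u}))"
        using finite_run_limited_words by (intro card_SigmaI) auto
      also have "\<dots> = (\<Sum>u\<in>run_limited_words m (n - r). 2)"
      proof (intro sum.cong refl)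
        fix u assume u: "u \<in> run_limited_words m (n - r)"
        then have "u \<noteq> []" "set u \<subseteq> {0,1,2}" using that by (auto simp: run_limited_words_def)
        then have "last u \<in> {0,1,2}" using last_in_set by blast
        then show "card ({0,1,2} - {last u}) = 2" by (subst card_Diff_singleton) auto
      qed
      finally show ?thesis by simp
    qed
    then have "(\<Sum>r\<in>?R. card (?A r)) \<le> (\<Sum>r\<in>?R. 2 * card (run_limited_words m (n - r)))"
      by (rule sum_mono)
    moreover have "card (\<Union>r\<in>?R. ?A r) \<le> (\<Sum>r\<in>?R. card (?A r))"
      by (intro card_UN_le) simp
    ultimately show "card (\<Union>r\<in>?R. ?A r) \<le> (\<Sum>r\<in>?R. 2 * card (run_limited_words m (n - r)))"
      by (rule order.trans[rotated])
  qed
  finally show ?thesis .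
qed

text \<open>
  Induction on the recursive estimate: with \<open>K\<close> the bound on the right, multiplication of the estimate
  by \<open>t^n\<close> gives \<open>3 + \<sigma> K = K\<close>, where \<open>\<sigma> = 2(t + \<dots> + t^(m-1))\<close>.
\<close>

lemma card_run_limited_words_growth:
  fixes t :: real
  assumes t: "0 < t" "t < 1" and less1: "2 * (\<Sum>r=1..<m. t ^ r) < 1"
  shows "card (run_limited_words m n) * t ^ n \<le> 3 / (1 - 2 * (\<Sum>r=1..<m. t ^ r))"
    (is "_ \<le> ?K")
proof (induction n rule: less_induct)
  case (less n)
  define \<sigma> where "\<sigma> = 2 * (\<Sum>r=1..<m. t ^ r)"
  let ?R = "{r\<in>{1..<m}. r < n}"
  have K0: "0 \<le> ?K" using less1 by simp
  have "real (card (run_limited_words m n)) \<le>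
      real (3 + (\<Sum>r\<in>?R. 2 * card (run_limited_words m (n - r))))"
    using card_run_limited_words_le by (rule of_nat_mono)
  also have "\<dots> = 3 + (\<Sum>r\<in>?R. 2 * real (card (run_limited_words m (n - r))))"
    by simp
  finally have "card (run_limited_words m n) * t ^ n \<le>
      (3 + (\<Sum>r\<in>?R. 2 * real (card (run_limited_words m (n - r))))) * t ^ n"
    using t(1) by (intro mult_right_mono) simp_all
  also have "\<dots> = 3 * t ^ n + (\<Sum>r\<in>?R. 2 * t ^ r * (card (run_limited_words m (n - r)) * t ^ (n - r)))"
  proof -
    have "t ^ n = t ^ r * t ^ (n - r)" if "r \<in> ?R" for r
      using that by (simp flip: power_add)
    then have "(\<Sum>r\<in>?R. 2 * real (card (run_limited_words m (n - r)))) * t ^ n =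
        (\<Sum>r\<in>?R. 2 * t ^ r * (card (run_limited_words m (n - r)) * t ^ (n - r)))"
      unfolding sum_distrib_right by (intro sum.cong refl) (simp only: mult_ac)
    then show ?thesis by (simp only: distrib_right)
  qed
  also have "\<dots> \<le> 3 * 1 + (\<Sum>r\<in>?R. 2 * t ^ r * ?K)"
    using t less by (intro add_mono mult_left_mono sum_mono) (auto simp: power_le_one)
  also have "(\<Sum>r\<in>?R. 2 * t ^ r * ?K) \<le> (\<Sum>r=1..<m. 2 * t ^ r * ?K)"
    using t K0 by (intro sum_mono2) auto
  also have "(\<Sum>r=1..<m. 2 * t ^ r * ?K) = \<sigma> * ?K"
    by (simp only: \<sigma>_def sum_distrib_left sum_distrib_right)
  also have "3 * 1 + \<sigma> * ?K = ?K"
    using less1 unfolding \<sigma>_def[symmetric] by (simp add: field_simps)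
  finally show ?case by simp
qed

context multinacci_ratio
begin

lemma uniqueness_set_cover:
  "uniqueness_set lam \<subseteq> (\<Union>w\<in>run_limited_words m n. foldr (ifs_map lam) w ` cball 0 1)"
proof
  fix x assume x: "x \<in> uniqueness_set lam"
  then obtain \<epsilon> where e: "\<epsilon> \<in> address_space" "x = address_point lam \<epsilon>"
    unfolding uniqueness_set_def invariant_set_eq by blast
  define w where "w = map \<epsilon> [0..<n]"
  have "i = j" if w: "w = u @ [i] @ replicate m j @ v" for u i j v
  proof -
    have "length w = n" by (simp add: w_def)
    then have len: "length u + Suc m \<le> n" using w by simp
    have nth: "\<epsilon> k = w ! k" if "k < n" for k using that by (simp add: w_def)
    have "\<epsilon> (length u + k) = j" if "k \<in> {1..m}" for k
      using nth[of "length u + k"] that len by (auto simp: w nth_append)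
    then have "\<epsilon> (length u) = j"
      using unique_address_avoids x e by blast
    then show ?thesis using nth[of "length u"] len by (simp add: w nth_append)
  qed
  moreover have "set w \<subseteq> {0,1,2}"
  proof -
    have digit: "\<epsilon> k \<in> {0,1,2}" for k using e(1) unfolding address_space_def by blast
    show ?thesis unfolding w_def set_map by (intro image_subsetI digit)
  qed
  moreover have "length w = n" by (simp add: w_def)
  ultimately have "w \<in> run_limited_words m n"
    unfolding run_limited_words_def by blast
  moreover have "x = foldr (ifs_map lam) w (address_point lam (shift n \<epsilon>))"
    using e(2) address_point_prefix[of \<epsilon> n] by (simp add: w_def foldr_map comp_def)
  moreover have "address_point lam (shift n \<epsilon>) \<in> cball 0 1" using norm_address_point by simp
  ultimately show "x \<in> (\<Union>w\<in>run_limited_words m n. foldr (ifs_map lam) w ` cball 0 1)" by blast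
qed

lemma hausdorff_dim_uniqueness_le:
  assumes t: "0 < t" "t < 1" "2 * (\<Sum>r=1..<m. t ^ r) < 1" and "0 < s" "lam powr s < t"
  shows "hausdorff_dim (uniqueness_set lam) \<le> ennreal s"
proof (rule hausdorff_dim_le)
  let ?F = "\<lambda>n. (\<lambda>w. foldr (ifs_map lam) w ` cball 0 1) ` run_limited_words m n"
  let ?d = "\<lambda>n. lam ^ n * 2"
  show "hausdorff_measure s (uniqueness_set lam) = 0"
  proof (rule hausdorff_null_finite_covers[OF \<open>0 < s\<close>])
    show "finite (?F n) \<and> uniqueness_set lam \<subseteq> \<Union>(?F n)" for n
      using uniqueness_set_cover finite_run_limited_words by blast
    show "bounded B \<and> diameter B \<le> ?d n" if B: "B \<in> ?F n" for n B
    proof -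
      obtain w where w: "length w = n" "B = foldr (ifs_map lam) w ` cball 0 1"
        using B by (auto simp: run_limited_words_def)
      have le: "dist x y \<le> ?d n" if "x \<in> B" "y \<in> B" for x y
      proof -
        obtain u v where uv: "u \<in> cball 0 1" "v \<in> cball 0 1"
          "x = foldr (ifs_map lam) w u" "y = foldr (ifs_map lam) w v"
          using \<open>x \<in> B\<close> \<open>y \<in> B\<close> w(2) by blast
        have "dist u v \<le> dist 0 u + dist 0 v" using dist_triangle3[of u v 0] by (simp add: dist_commute)
        then have "dist u v \<le> 2" using uv(1,2) by simp
        then show ?thesis using uv w(1) power_bounds(1)[of n] by (simp add: dist_foldr_ifs_map mult_left_mono)
      qed
      have "bounded B" unfolding bounded_any_center[where a = "foldr (ifs_map lam) w 0"]
        using le w(2) by (intro exI[of _ "?d n"]) auto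
      moreover have "diameter B \<le> ?d n"
        using le power_bounds(1)[of n] by (intro diameter_le) (auto simp: dist_norm)
      ultimately show ?thesis ..
    qed
    show "?d \<longlonglongrightarrow> 0"
      using LIMSEQ_realpow_zero lam_pos lam_less_1 by (intro tendsto_mult_left_zero) auto
    show "0 \<le> ?d n" for n using power_bounds(1) by simp
    define K where "K = 3 / (1 - 2 * (\<Sum>r=1..<m. t ^ r))"
    have "(\<lambda>n. K * 2 powr s * (lam powr s / t) ^ n) \<longlonglongrightarrow> 0"
      using assms by (intro tendsto_mult_right_zero LIMSEQ_realpow_zero) auto
    then show "(\<lambda>n. card (?F n) * ?d n powr s) \<longlonglongrightarrow> 0"
    proof (rule Lim_null_comparison[rotated], intro always_eventually allI)
      fix n
      have d: "?d n powr s = 2 powr s * (lam powr s / t) ^ n * t ^ n"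
        using lam_pos t(1)
        by (simp add: powr_mult power_divide powr_powr powr_realpow[symmetric] mult.commute)
      have "card (?F n) * ?d n powr s \<le> card (run_limited_words m n) * ?d n powr s"
        using card_image_le[OF finite_run_limited_words] by (intro mult_right_mono) auto
      also have "\<dots> = 2 powr s * (lam powr s / t) ^ n * (card (run_limited_words m n) * t ^ n)"
        by (simp add: d)
      also have "\<dots> \<le> 2 powr s * (lam powr s / t) ^ n * K"
        using card_run_limited_words_growth[OF t] t(1) unfolding K_def by (intro mult_left_mono) auto
      finally show "norm (card (?F n) * ?d n powr s) \<le> K * 2 powr s * (lam powr s / t) ^ n"
        by (simp add: mult_ac)
    qed
  qed
qed (use assms in simp)

end

section \<open>Counting the cells of the attractor\<close>

context multinacci_ratio
begin

text \<open>
  The map \<open>f\<^sub>j^r\<close> in barycentric coordinates with respect to the three vertices.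
\<close>

definition shrink :: "nat \<Rightarrow> nat \<Rightarrow> (nat \<Rightarrow> real) \<Rightarrow> nat \<Rightarrow> real" where
  "shrink r j c = (\<lambda>i. (1 - lam ^ r) * of_bool (i = j) + lam ^ r * c i)"

text \<open>
  The cells of level \<open>n\<close>, each represented once: the image of \<open>z\<close> under a composition \<open>f\<^sub>w\<close> with
  \<open>n\<close> factors is \<open>c 0 *\<^sub>R vertex 0 + c 1 *\<^sub>R vertex 1 + c 2 *\<^sub>R vertex 2 + \<lambda>^n *\<^sub>R z\<close> for one such
  coordinate vector \<open>c\<close>, and words with the same \<open>c\<close> give the same map.
\<close>

primrec coords :: "nat \<Rightarrow> (nat \<Rightarrow> real) set" where
  "coords 0 = {\<lambda>_. 0}"
| "coords (Suc n) = (\<Union>j\<in>{0,1,2}. shrink 1 j ` coords n)"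

lemma shrink_shrink: "shrink r j (shrink s j c) = shrink (r + s) j c"
  by (rule ext) (simp add: shrink_def power_add algebra_simps)

lemma shrink_swap: "shrink 1 i (shrink m j c) = shrink 1 j (shrink m i c)"
proof
  fix k
  have "shrink 1 i (shrink m j c) k = (1 - lam) * of_bool (k = i) +
      lam * (1 - lam ^ m) * of_bool (k = j) + lam ^ Suc m * c k" for i j
    by (simp add: shrink_def algebra_simps)
  then show "shrink 1 i (shrink m j c) k = shrink 1 j (shrink m i c) k"
    unfolding multinacci_eq by simp
qed

lemma shrink_inject: "shrink r j c = shrink r j d \<longleftrightarrow> c = d"
proof
  assume eq: "shrink r j c = shrink r j d"
  have "c i = d i" for i
    using fun_cong[OF eq, of i] lam_pos by (simp add: shrink_def)
  then show "c = d" by blast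
qed simp

lemma finite_coords: "finite (coords n)"
  by (induction n) auto

lemma coords_SucI: "j \<in> {0,1,2} \<Longrightarrow> c \<in> coords n \<Longrightarrow> shrink 1 j c \<in> coords (Suc n)"
  unfolding coords.simps by blast

lemma coords_SucE:
  assumes "c \<in> coords (Suc n)"
  obtains j d where "j \<in> {0,1,2}" "d \<in> coords n" "c = shrink 1 j d"
  using assms unfolding coords.simps by blast

lemma shrink_coords: "j \<in> {0,1,2} \<Longrightarrow> c \<in> coords n \<Longrightarrow> shrink r j c \<in> coords (r + n)"
proof (induction r)
  case 0
  have "shrink 0 j c = c" by (simp add: shrink_def)
  then show ?case using 0 by simp
next
  case (Suc r)
  then have "shrink 1 j (shrink r j c) \<in> coords (Suc (r + n))" by (intro coords_SucI) auto
  then show ?case by (simp add: shrink_shrink)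
qed

lemma coords_bounds:
  assumes "c \<in> coords n"
  shows "0 \<le> c i" "c i \<le> 1 - lam ^ n"
proof -
  have "0 \<le> c i \<and> c i \<le> 1 - lam ^ n"
    using assms
  proof (induction n arbitrary: c)
    case (Suc n)
    from Suc.prems obtain j d where d: "d \<in> coords n" "c = shrink 1 j d" by (rule coords_SucE)
    have "0 \<le> lam * d i" "lam * d i \<le> lam * (1 - lam ^ n)"
      using Suc.IH[OF d(1)] lam_pos by (auto intro: mult_left_mono)
    then show ?case using d(2) lam_less_1 by (auto simp: shrink_def of_bool_def algebra_simps)
  qed simp
  then show "0 \<le> c i" "c i \<le> 1 - lam ^ n" by auto
qed

lemma coords_outside: "c \<in> coords n \<Longrightarrow> 3 \<le> i \<Longrightarrow> c i = 0"
proof (induction n arbitrary: c)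
  case (Suc n)
  from Suc.prems(1) obtain j d where "j \<in> {0,1,2}" "d \<in> coords n" "c = shrink 1 j d"
    by (rule coords_SucE)
  then show ?case using Suc.IH Suc.prems(2) by (auto simp: shrink_def)
qed simp

lemma coords_sum: "c \<in> coords n \<Longrightarrow> c 0 + c 1 + c 2 = 1 - lam ^ n"
proof (induction n arbitrary: c)
  case (Suc n)
  from Suc.prems(1) obtain j d where d: "j \<in> {0,1,2}" "d \<in> coords n" "c = shrink 1 j d"
    by (rule coords_SucE)
  then have "c 0 + c 1 + c 2 = (1 - lam) + lam * (d 0 + d 1 + d 2)"
    by (auto simp: shrink_def algebra_simps)
  then show ?case unfolding Suc.IH[OF d(2)] by (simp add: algebra_simps)
qed simp

text \<open>
  A cell that is close enough to the vertex \<open>j\<close> to lie in \<open>f\<^sub>j^r\<close> of the full triangle is \<open>f\<^sub>j^r\<close> of a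
  cell, even if its word begins differently: the overlap of the triangles of \<open>f\<^sub>k\<close> and \<open>f\<^sub>j\<close> is the
  triangle of \<open>f\<^sub>k f\<^sub>j^m\<close>, so by induction the word may be taken to begin with \<open>k j^m\<close>, which can be
  rewritten to \<open>j k^m\<close>.
\<close>

lemma coords_corner:
  assumes "c \<in> coords n" "r \<le> m" "1 - lam ^ r \<le> c j" "j \<in> {0,1,2}"
  shows "r \<le> n \<and> (\<exists>d\<in>coords (n - r). c = shrink r j d)"
  using assms
proof (induction n arbitrary: c r j rule: less_induct)
  case (less n)
  show ?case
  proof (cases r)
    case 0
    have "shrink 0 j c = c" by (simp add: shrink_def)
    then show ?thesis using 0 less.prems(1) by (intro conjI bexI[of _ c]) simp_all
  next
    case (Suc r')
    have "lam ^ n \<le> lam ^ r" using less.prems(3) coords_bounds(2)[OF less.prems(1), of j] by simp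
    then have "r \<le> n" using lam_pos lam_less_1 by (simp add: power_decreasing_iff)
    then obtain n' where n: "n = Suc n'" using Suc by (cases n) auto
    from less.prems(1) n obtain k e where k: "k \<in> {0,1,2}" "e \<in> coords n'" "c = shrink 1 k e"
      by (auto elim: coords_SucE)
    have "\<exists>e'\<in>coords n'. c = shrink 1 j e'"
    proof (cases "k = j")
      case True
      then show ?thesis using k by blast
    next
      case False
      have "1 - lam \<le> c j"
        using less.prems(3) Suc mult_left_le[OF power_bounds(2)[of r'], of lam] lam_pos
        unfolding Suc power_Suc by linarith
      then have "lam * (1 - lam ^ m) \<le> lam * e j"
        using False k(3) unfolding multinacci_eq by (simp add: shrink_def)
      then have "1 - lam ^ m \<le> e j" using lam_pos by simp
      with less.IH[of n' e m j] n k(2) less.prems(4)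
      obtain d where d: "m \<le> n'" "d \<in> coords (n' - m)" "e = shrink m j d" by auto
      have "shrink m k d \<in> coords (m + (n' - m))" using k(1) d(2) by (rule shrink_coords)
      moreover have "c = shrink 1 j (shrink m k d)" using k(3) d(3) shrink_swap by simp
      ultimately show ?thesis using d(1) by auto
    qed
    then obtain e' where e': "e' \<in> coords n'" "c = shrink 1 j e'" by blast
    have "lam * (1 - lam ^ r') \<le> lam * e' j"
      using less.prems(3) Suc e'(2) by (simp add: shrink_def algebra_simps)
    then have "1 - lam ^ r' \<le> e' j" using lam_pos by simp
    with less.IH[of n' e' r' j] n e'(1) less.prems(2,4) Suc
    obtain d where "r' \<le> n'" "d \<in> coords (n' - r')" "e' = shrink r' j d" by auto
    then show ?thesis using e'(2) n Suc by (auto simp: shrink_shrink)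
  qed
qed

lemma card_overlap_le:
  assumes "i \<in> {0,1,2}" "j \<in> {0,1,2}" "i \<noteq> j"
  shows "card (shrink 1 i ` coords n \<inter> shrink 1 j ` coords n)
    \<le> (if m \<le> n then card (coords (n - m)) else 0)"
proof -
  have sub: "shrink 1 i ` coords n \<inter> shrink 1 j ` coords n
      \<subseteq> (if m \<le> n then (\<lambda>d. shrink 1 i (shrink m j d)) ` coords (n - m) else {})"
  proof
    fix c assume "c \<in> shrink 1 i ` coords n \<inter> shrink 1 j ` coords n"
    then obtain e e' where e: "e \<in> coords n" "c = shrink 1 i e" "e' \<in> coords n" "c = shrink 1 j e'"
      by blast
    have "1 - lam \<le> c j"
      using e(4) coords_bounds(1)[OF e(3), of j] lam_pos by (simp add: shrink_def)
    then have "lam * (1 - lam ^ m) \<le> lam * e j"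
      using assms(3) e(2) unfolding multinacci_eq by (simp add: shrink_def)
    then have "1 - lam ^ m \<le> e j" using lam_pos by simp
    from coords_corner[OF e(1) order.refl this assms(2)] e(2)
    show "c \<in> (if m \<le> n then (\<lambda>d. shrink 1 i (shrink m j d)) ` coords (n - m) else {})" by auto
  qed
  then have "card (shrink 1 i ` coords n \<inter> shrink 1 j ` coords n)
      \<le> card (if m \<le> n then (\<lambda>d. shrink 1 i (shrink m j d)) ` coords (n - m) else {})"
    using finite_coords by (intro card_mono) auto
  also have "\<dots> \<le> (if m \<le> n then card (coords (n - m)) else 0)"
    using card_image_le[OF finite_coords] by auto
  finally show ?thesis .
qed

lemma card_Un3_ge:
  assumes "finite A" "finite B" "finite C"
  shows "card A + card B + card C \<le>
    card (A \<union> B \<union> C) + card (A \<inter> B) + card (A \<inter> C) + card (B \<inter> C)"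
proof -
  have "card A + card B = card (A \<union> B) + card (A \<inter> B)"
    using assms by (intro card_Un_Int) auto
  moreover have "card (A \<union> B) + card C = card (A \<union> B \<union> C) + card ((A \<union> B) \<inter> C)"
    using assms by (intro card_Un_Int) auto
  moreover have "card ((A \<union> B) \<inter> C) \<le> card (A \<inter> C) + card (B \<inter> C)"
    unfolding Int_Un_distrib2 by (rule card_Un_le)
  ultimately show ?thesis by linarith
qed

lemma card_coords_Suc_ge:
  "3 * card (coords n) \<le> card (coords (Suc n)) + 3 * (if m \<le> n then card (coords (n - m)) else 0)"
proof -
  let ?A = "\<lambda>j. shrink 1 j ` coords n"
  have card: "card (?A j) = card (coords n)" for j
    by (intro card_image inj_onI) (simp only: shrink_inject)
  have "coords (Suc n) = ?A 0 \<union> ?A 1 \<union> ?A 2" by auto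
  moreover have "card (?A 0) + card (?A 1) + card (?A 2) \<le> card (?A 0 \<union> ?A 1 \<union> ?A 2) +
     card (?A 0 \<inter> ?A 1) + card (?A 0 \<inter> ?A 2) + card (?A 1 \<inter> ?A 2)"
    using finite_coords by (intro card_Un3_ge) auto
  moreover note card_overlap_le[of 0 1 n] card_overlap_le[of 0 2 n] card_overlap_le[of 1 2 n]
  ultimately show ?thesis unfolding card by simp
qed

text \<open>
  By induction \<open>q(n-m) \<le> t^m q(n)\<close>, so that
  \<open>t q(n+1) \<ge> t (3 - 3t^m) q(n) \<ge> q(n)\<close>.
\<close>

lemma card_coords_ratio:
  fixes t :: real
  assumes t: "0 < t" "1 + 3 * t ^ Suc m \<le> 3 * t"
  shows "card (coords n) \<le> t * card (coords (Suc n))"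
proof (induction n rule: less_induct)
  case (less n)
  have iter: "card (coords (n - k)) \<le> t ^ k * card (coords n)" if "k \<le> n" for k
    using that
  proof (induction k)
    case (Suc k)
    then have "card (coords (n - Suc k)) \<le> t * card (coords (Suc (n - Suc k)))"
      by (intro less) simp
    also have "Suc (n - Suc k) = n - k" using Suc by simp
    also have "t * card (coords (n - k)) \<le> t * (t ^ k * card (coords n))"
      using Suc t(1) by (intro mult_left_mono) auto
    finally show ?case by simp
  qed simp
  have "real (3 * card (coords n)) \<le>
      real (card (coords (Suc n)) + 3 * (if m \<le> n then card (coords (n - m)) else 0))"
    using card_coords_Suc_ge by (rule of_nat_mono)
  also have "\<dots> \<le> card (coords (Suc n)) + 3 * (t ^ m * card (coords n))"
    using iter[of m] t(1) by auto
  finally have "t * (3 * card (coords n)) \<le> t * (card (coords (Suc n)) + 3 * (t ^ m * card (coords n)))"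
    using t(1) by (intro mult_left_mono) auto
  moreover have "(1 + 3 * t ^ Suc m) * card (coords n) \<le> (3 * t) * card (coords n)"
    using t(2) by (intro mult_right_mono) auto
  ultimately show ?case by (simp add: algebra_simps)
qed

lemma card_coords_descend:
  fixes t :: real
  assumes t: "0 < t" "1 + 3 * t ^ Suc m \<le> 3 * t"
  shows "card (coords n) \<le> t ^ k * card (coords (n + k))"
proof (induction k)
  case (Suc k)
  have "t ^ k * card (coords (n + k)) \<le> t ^ k * (t * card (coords (Suc (n + k))))"
    using card_coords_ratio[OF t] t(1) by (intro mult_left_mono) simp_all
  also have "\<dots> = t ^ Suc k * card (coords (n + Suc k))"
    by (simp only: power_Suc add_Suc_right mult_ac)
  finally show ?case using Suc by simp
qed simp

lemma card_coords_pos: "0 < card (coords n)"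
proof -
  have "coords n \<noteq> {}"
    by (induction n) auto
  then show ?thesis using finite_coords card_gt_0_iff by blast
qed

lemma coords_split:
  "c \<in> coords (a + b) \<Longrightarrow> \<exists>d\<in>coords a. \<exists>e\<in>coords b. c = (\<lambda>i. d i + lam ^ a * e i)"
proof (induction a arbitrary: c)
  case 0
  then show ?case by simp
next
  case (Suc a)
  from Suc.prems have "c \<in> coords (Suc (a + b))" by simp
  then obtain j c' where c: "j \<in> {0,1,2}" "c' \<in> coords (a + b)" "c = shrink 1 j c'"
    by (rule coords_SucE)
  from Suc.IH[OF c(2)] obtain d e where de: "d \<in> coords a" "e \<in> coords b"
    "c' = (\<lambda>i. d i + lam ^ a * e i)" by blast
  have "c = (\<lambda>i. shrink 1 j d i + lam ^ Suc a * e i)"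
    by (rule ext) (simp add: c(3) de(3) shrink_def algebra_simps)
  then show ?case using coords_SucI[OF c(1) de(1)] de(2) by blast
qed

section \<open>Separation of cells\<close>

text \<open>
  The difference of one coordinate of two cells, measured in units of \<open>\<lambda>^n\<close>, changes by
  \<open>x \<mapsto> (x + (1-\<lambda>)d) / \<lambda>\<close> with \<open>d \<in> {-1,0,1}\<close> when a symbol is appended to both words. Differences of
  absolute value at least 1 keep this property, and 0 moves to 0 or \<open>\<plusminus>(1 - \<lambda>^m)\<close>.
  Up to sign, from \<open>1 - \<lambda>^r\<close> the move \<open>d = -1\<close> leads to
  \<open>1 - \<lambda>^(r-1)\<close>, the move \<open>d = 0\<close> leads back to \<open>1 - \<lambda>^m\<close> if \<open>r = 1\<close>, and every other move leads
  to absolute value at least 1. So only finitely many small values ever occur.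
\<close>

lemma separation_step:
  assumes x: "x = 0 \<or> (\<exists>r\<in>{1..m}. \<bar>x\<bar> = 1 - lam ^ r) \<or> 1 \<le> \<bar>x\<bar>"
    and d: "d \<in> {-1, 0, 1}"
    and y: "lam * y = x + (1 - lam) * d"
  shows "y = 0 \<or> (\<exists>r\<in>{1..m}. \<bar>y\<bar> = 1 - lam ^ r) \<or> 1 \<le> \<bar>y\<bar>"
proof -
  have m1: "m \<in> {1..m}" using m_ge_2 by simp
  have large: "1 \<le> \<bar>y\<bar>" if "lam \<le> \<bar>lam * y\<bar>"
    using that lam_pos by (simp add: abs_mult)
  have m_case: "\<bar>y\<bar> = 1 - lam ^ m" if "\<bar>lam * y\<bar> = 1 - lam"
  proof -
    have "lam * \<bar>y\<bar> = lam * (1 - lam ^ m)" using that lam_pos by (simp add: abs_mult multinacci_eq)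
    then show ?thesis using lam_pos by simp
  qed
  have pos: "y = 0 \<or> (\<exists>r\<in>{1..m}. \<bar>y\<bar> = 1 - lam ^ r) \<or> 1 \<le> \<bar>y\<bar>"
    if r: "r \<in> {1..m}" "x = 1 - lam ^ r" and d: "d \<in> {-1, 0, 1}"
      and y: "lam * y = x + (1 - lam) * d" for x y d r
  proof -
    obtain r' where r': "r = Suc r'" using r(1) by (cases r) auto
    have large: "1 \<le> \<bar>y\<bar>" if "lam \<le> \<bar>lam * y\<bar>"
      using that lam_pos by (simp add: abs_mult)
    consider "d = 1" | "d = 0" | "d = -1" using d by auto
    then show ?thesis
    proof cases
      case 1
      have "lam ^ r \<le> lam * 1" unfolding r' power_Suc
        using lam_pos power_bounds(2) by (intro mult_left_mono) auto
      then have "lam \<le> lam * y" using y r 1 ratio_le_two_thirds by simp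
      then show ?thesis using large by simp
    next
      case 2
      show ?thesis
      proof (cases "r' = 0")
        case True
        then have "lam * y = lam * (1 - lam ^ m)" using y r r' 2 by (simp add: multinacci_eq)
        then have "y = 1 - lam ^ m" using lam_pos by simp
        then have "\<bar>y\<bar> = 1 - lam ^ m" using power_bounds(2)[of m] by simp
        then show ?thesis using m1 by blast
      next
        case False
        then have "lam ^ r \<le> lam ^ 2"
          using lam_pos lam_less_1 r' by (intro power_decreasing) auto
        then have "lam \<le> lam * y" using y r 2 sum_first_two_le by simp
        then show ?thesis using large by simp
      qed
    next
      case 3
      then have "lam * y = lam * (1 - lam ^ r')" using y r r' by (simp add: algebra_simps)
      then have y': "y = 1 - lam ^ r'" using lam_pos by simp
      show ?thesis
      proof (cases "r' = 0")
        case False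
        then have "r' \<in> {1..m}" "\<bar>y\<bar> = 1 - lam ^ r'" using r(1) r' y' power_bounds(2)[of r'] by auto
        then show ?thesis by blast
      qed (simp add: y')
    qed
  qed
  from x consider "x = 0" | r where "r \<in> {1..m}" "x = 1 - lam ^ r"
    | r where "r \<in> {1..m}" "- x = 1 - lam ^ r" | "1 \<le> \<bar>x\<bar>"
    by (metis abs_if)
  then show ?thesis
  proof cases
    case 1
    with d consider "lam * y = 0" | "\<bar>lam * y\<bar> = 1 - lam" using y lam_less_1 by auto
    then show ?thesis
    proof cases
      case 2
      then show ?thesis using m_case m1 by blast
    qed (use lam_pos in simp)
  next
    case (2 r)
    then show ?thesis using pos[OF 2 d y] by blast
  next
    case (3 r)
    have "- d \<in> {-1, 0, 1}" "lam * (- y) = - x + (1 - lam) * (- d)" using d y by auto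
    from pos[OF 3 this] show ?thesis by simp
  next
    case 4
    have "\<bar>(1 - lam) * d\<bar> \<le> 1 - lam" using d lam_less_1 by auto
    then have "lam \<le> \<bar>lam * y\<bar>" using y 4 by linarith
    then show ?thesis using large by blast
  qed
qed

lemma coords_difference:
  assumes "c \<in> coords n" "c' \<in> coords n"
  shows "\<exists>x. c i - c' i = lam ^ n * x \<and>
    (x = 0 \<or> (\<exists>r\<in>{1..m}. \<bar>x\<bar> = 1 - lam ^ r) \<or> 1 \<le> \<bar>x\<bar>)"
  using assms
proof (induction n arbitrary: c c')
  case 0
  then show ?case by simp
next
  case (Suc n)
  have one: "\<exists>a\<in>{0, 1 - lam}. e i = a" if e: "e \<in> coords 1" for e
    using e by (auto simp: shrink_def)
  from Suc.prems obtain d e where c: "d \<in> coords n" "e \<in> coords 1" "c = (\<lambda>i. d i + lam ^ n * e i)"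
    using coords_split[of c n 1] by auto
  from Suc.prems obtain d' e' where c': "d' \<in> coords n" "e' \<in> coords 1" "c' = (\<lambda>i. d' i + lam ^ n * e' i)"
    using coords_split[of c' n 1] by auto
  from Suc.IH[OF c(1) c'(1)] obtain x where x: "d i - d' i = lam ^ n * x"
    "x = 0 \<or> (\<exists>r\<in>{1..m}. \<bar>x\<bar> = 1 - lam ^ r) \<or> 1 \<le> \<bar>x\<bar>" by blast
  \<comment> \<open>the symbol appended to a word contributes \<open>1 - \<lambda>\<close> to its own coordinate and 0 to the others\<close>
  define \<delta> where "\<delta> = (e i - e' i) / (1 - lam)"
  have "(lam - 1) / (1 - lam) = -1" using lam_less_1 by (simp add: divide_eq_eq)
  then have \<delta>: "\<delta> \<in> {-1, 0, 1}" "e i - e' i = (1 - lam) * \<delta>"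
    using one[OF c(2)] one[OF c'(2)] lam_less_1 by (auto simp: \<delta>_def)
  define y where "y = (x + (1 - lam) * \<delta>) / lam"
  have y: "lam * y = x + (1 - lam) * \<delta>" using lam_pos by (simp add: y_def)
  have "c i - c' i = (d i - d' i) + lam ^ n * (e i - e' i)"
    by (simp add: c(3) c'(3) algebra_simps)
  also have "\<dots> = lam ^ n * (lam * y)" by (simp add: x(1) \<delta>(2) y algebra_simps)
  finally have "c i - c' i = lam ^ Suc n * y" by simp
  with separation_step[OF x(2) \<delta>(1) y] show ?case by blast
qed

lemma coords_separated:
  assumes "c \<in> coords n" "c' \<in> coords n" "\<bar>c i - c' i\<bar> < (1 - lam) * lam ^ n"
  shows "c i = c' i"
proof -
  obtain x where x: "c i - c' i = lam ^ n * x"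
    "x = 0 \<or> (\<exists>r\<in>{1..m}. \<bar>x\<bar> = 1 - lam ^ r) \<or> 1 \<le> \<bar>x\<bar>"
    using coords_difference[OF assms(1,2)] by blast
  have "1 - lam \<le> 1 - lam ^ r" if "r \<in> {1..m}" for r
    using that lam_pos lam_less_1 power_decreasing[of 1 r lam] by simp
  then have "x = 0 \<or> 1 - lam \<le> \<bar>x\<bar>" using x(2) lam_pos by force
  moreover have "\<bar>x\<bar> < 1 - lam"
    using assms(3) lam_pos unfolding x(1) by (simp add: abs_mult mult.commute)
  ultimately show ?thesis using x(1) by simp
qed

text \<open>
  Rounding to a grid of mesh \<open>(1-\<lambda>)\<lambda>^n\<close> is injective on cells by separation, and only boundedly many
  grid points are within reach.
\<close>

lemma card_clustered_coords:
  obtains B :: nat where "\<And>n Q. Q \<subseteq> coords n \<Longrightarrow>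
    (\<And>c c' i. c \<in> Q \<Longrightarrow> c' \<in> Q \<Longrightarrow> i < 3 \<Longrightarrow> \<bar>c i - c' i\<bar> \<le> 3 * lam ^ n) \<Longrightarrow> card Q \<le> B"
proof -
  define K where "K = \<lceil>3 / (1 - lam)\<rceil> + 1"
  define G where "G = {-K..K} \<times> {-K..K} \<times> {-K..K}"
  have "card Q \<le> card G" if Q: "Q \<subseteq> coords n"
    and close: "\<And>c c' i. c \<in> Q \<Longrightarrow> c' \<in> Q \<Longrightarrow> i < 3 \<Longrightarrow> \<bar>c i - c' i\<bar> \<le> 3 * lam ^ n" for n Q
  proof (cases "Q = {}")
    case False
    then obtain c\<^sub>0 where c\<^sub>0: "c\<^sub>0 \<in> Q" by blast
    define h where "h = (1 - lam) * lam ^ n"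
    have h: "0 < h" using lam_pos lam_less_1 by (simp add: h_def)
    define \<phi> where "\<phi> c i = \<lfloor>(c i - c\<^sub>0 i) / h\<rfloor>" for c i
    have range: "\<phi> c i \<in> {-K..K}" if "c \<in> Q" "i < 3" for c i
    proof -
      have "\<bar>(c i - c\<^sub>0 i) / h\<bar> \<le> 3 * lam ^ n / h"
        using close[OF that(1) c\<^sub>0 that(2)] h by (simp add: divide_right_mono)
      also have "\<dots> = 3 / (1 - lam)" using lam_pos by (simp add: h_def)
      finally have "\<bar>(c i - c\<^sub>0 i) / h\<bar> \<le> of_int \<lceil>3 / (1 - lam)\<rceil>" by linarith
      then have "- K \<le> \<phi> c i" "\<phi> c i \<le> K" unfolding \<phi>_def K_def by linarith+
      then show ?thesis by simp
    qed
    have "inj_on (\<lambda>c. (\<phi> c 0, \<phi> c 1, \<phi> c 2)) Q"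
    proof (rule inj_onI)
      fix c c' assume c: "c \<in> Q" "c' \<in> Q"
        and eq: "(\<phi> c 0, \<phi> c 1, \<phi> c 2) = (\<phi> c' 0, \<phi> c' 1, \<phi> c' 2)"
      have "c i = c' i" for i
      proof (cases "i < 3")
        case True
        then have "i = 0 \<or> i = 1 \<or> i = 2" by auto
        then have "\<phi> c i = \<phi> c' i" using eq by auto
        then have "\<bar>(c i - c\<^sub>0 i) / h - (c' i - c\<^sub>0 i) / h\<bar> < 1"
          unfolding \<phi>_def by linarith
        then have "\<bar>c i - c' i\<bar> < h"
          using h by (simp add: abs_divide flip: diff_divide_distrib)
        then show ?thesis using coords_separated c Q unfolding h_def by blast
      next
        case False
        then have "3 \<le> i" by simp
        with Q c show ?thesis using coords_outside[of _ n i] by (metis subsetD)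
      qed
      then show "c = c'" by blast
    qed
    moreover have "(\<lambda>c. (\<phi> c 0, \<phi> c 1, \<phi> c 2)) ` Q \<subseteq> G"
      using range unfolding G_def by auto
    ultimately show ?thesis by (intro card_inj_on_le) (auto simp: G_def)
  qed simp
  then show thesis by (rule that)
qed

definition cell_point :: "nat \<Rightarrow> (nat \<Rightarrow> real) \<Rightarrow> real^2 \<Rightarrow> real^2" where
  "cell_point n c z = c 0 *\<^sub>R vertex 0 + c 1 *\<^sub>R vertex 1 + c 2 *\<^sub>R vertex 2 + lam ^ n *\<^sub>R z"

lemma cell_point_in_invariant_set:
  "c \<in> coords n \<Longrightarrow> z \<in> invariant_set lam \<Longrightarrow> cell_point n c z \<in> invariant_set lam"
proof (induction n arbitrary: c)
  case 0
  then show ?case by (simp add: cell_point_def)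
next
  case (Suc n)
  from Suc.prems(1) obtain j d where d: "j \<in> {0,1,2}" "d \<in> coords n" "c = shrink 1 j d"
    by (rule coords_SucE)
  have "cell_point (Suc n) c z = ifs_map lam j (cell_point n d z)"
    using d(1) by (auto simp: cell_point_def d(3) shrink_def ifs_map_def algebra_simps)
  then show ?case using Suc d(1,2) ifs_map_invariant_set by simp
qed

text \<open>
  Coordinates are recovered by inner products with the vertices: because coordinate differences sum
  to 0, the inner product of the displacement with a vertex is \<open>2/3\<close> of that coordinate, and the
  vertex has norm \<open>2/3\<close>.
\<close>

lemma coord_le_dist_cell_point:
  assumes "c \<in> coords n" "c' \<in> coords n" "i < 3"
  shows "\<bar>c i - c' i\<bar> \<le> dist (cell_point n c z) (cell_point n c' z)"
proof -
  have i: "i = 0 \<or> i = 1 \<or> i = 2" using assms(3) by auto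
  have sum: "c 0 + c 1 + c 2 = c' 0 + c' 1 + c' 2"
    using coords_sum assms(1,2) by simp
  let ?v = "cell_point n c z - cell_point n c' z"
  define a b d where "a = c 0 - c' 0" and "b = c 1 - c' 1" and "d = c 2 - c' 2"
  have "?v = a *\<^sub>R vertex 0 + b *\<^sub>R vertex 1 + d *\<^sub>R vertex 2"
    by (simp add: cell_point_def a_def b_def d_def scaleR_diff_left)
  then have "?v \<bullet> vertex i =
      a * (vertex 0 \<bullet> vertex i) + b * (vertex 1 \<bullet> vertex i) + d * (vertex 2 \<bullet> vertex i)"
    by (simp add: inner_add_left)
  moreover have "a + b + d = 0" using sum by (simp add: a_def b_def d_def)
  ultimately have "?v \<bullet> vertex i = (2/3) * (if i = 0 then a else if i = 1 then b else d)"
    using i by (elim disjE) (simp_all add: vertex_inner)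
  also have "\<dots> = (2/3) * (c i - c' i)"
    using i by (auto simp: a_def b_def d_def)
  finally have "?v \<bullet> vertex i = (2/3) * (c i - c' i)" .
  then have "(2/3) * \<bar>c i - c' i\<bar> = \<bar>?v \<bullet> vertex i\<bar>" by (simp only: abs_mult)
  also have "\<dots> \<le> norm ?v * (2/3)"
    using Cauchy_Schwarz_ineq2[of ?v "vertex i"] by (simp add: norm_vertex)
  finally show ?thesis by (simp add: dist_norm)
qed

end

section \<open>Lower bound for the attractor\<close>

text \<open>
  A set of diameter 0 has gauge 0 for \<open>s > 0\<close>, so passing to balls of positive radius, as needed for
  compactness and for choosing a level, costs an arbitrarily small \<open>e\<close>.
\<close>

lemma radius_of_gauge:
  fixes U :: "'a::metric_space set"
  assumes "bounded U" "U \<noteq> {}" "diameter U < 1" "0 \<le> s" "0 < e"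
  obtains \<rho> where "diameter U < \<rho>" "0 < \<rho>" "\<rho> < 1"
    "ennreal (\<rho> powr s) \<le> hausdorff_gauge s U + ennreal e"
proof (cases "s = 0")
  case True
  have "diameter U < (diameter U + 1) / 2" "0 < (diameter U + 1) / 2" "(diameter U + 1) / 2 < 1"
    using assms(3) diameter_ge_0[OF assms(1)] by auto
  moreover have "ennreal (((diameter U + 1) / 2) powr s) \<le> hausdorff_gauge s U + ennreal e"
    using True assms(2) calculation(2) by (simp add: hausdorff_gauge_def)
  ultimately show thesis by (rule that)
next
  case False
  let ?d = "diameter U"
  have d: "0 \<le> ?d" using diameter_ge_0[OF assms(1)] .
  have "((\<lambda>\<rho>. \<rho> powr s) \<longlongrightarrow> ?d powr s) (at_right ?d)"
  proof (rule tendsto_powr')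
    show "?d \<noteq> 0 \<or> 0 < s \<and> (\<forall>\<^sub>F \<rho> in at_right ?d. 0 \<le> \<rho>)"
      using False assms(4) d eventually_at_right_less[of ?d] by (auto elim!: eventually_mono)
  qed (auto intro: tendsto_ident_at)
  then have "\<forall>\<^sub>F \<rho> in at_right ?d. \<rho> powr s < ?d powr s + e"
    using assms(5) by (intro order_tendstoD(2)) auto
  moreover have "\<forall>\<^sub>F \<rho> in at_right ?d. ?d < \<rho> \<and> \<rho> < 1"
    using assms(3) eventually_at_right_less eventually_at_right_field by (intro eventually_conj) blast+
  ultimately have "\<forall>\<^sub>F \<rho> in at_right ?d. \<rho> powr s < ?d powr s + e \<and> ?d < \<rho> \<and> \<rho> < 1"
    by (rule eventually_conj)
  then obtain \<rho> where \<rho>: "\<rho> powr s < ?d powr s + e" "?d < \<rho>" "\<rho> < 1"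
    using eventually_happens trivial_limit_at_right_real by blast
  have "ennreal (\<rho> powr s) \<le> ennreal (?d powr s + e)" using \<rho>(1) by (intro ennreal_leI) simp
  also have "\<dots> = hausdorff_gauge s U + ennreal e"
    using False assms(2,5) by (simp add: hausdorff_gauge_def)
  finally show thesis using that[of \<rho>] \<rho> d by simp
qed

context multinacci_ratio
begin

lemma level_of_radius:
  assumes "0 < \<rho>" "\<rho> < 1"
  obtains n where "lam ^ Suc n < \<rho>" "\<rho> \<le> lam ^ n"
proof -
  have ex: "\<exists>k. lam ^ k < \<rho>" using real_arch_pow_inv[OF assms(1) lam_less_1] .
  define k where "k = (LEAST k. lam ^ k < \<rho>)"
  have k: "lam ^ k < \<rho>" unfolding k_def using ex by (rule LeastI_ex)
  have "k \<noteq> 0" using k assms(2) by (cases k) auto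
  then obtain n where n: "k = Suc n" by (cases k) auto
  then have "\<not> lam ^ n < \<rho>" unfolding k_def using not_less_Least lessI by metis
  then show thesis using that[of n] k n by simp
qed

text \<open>
  Cells of level \<open>L\<close> in a ball of radius \<open>\<lambda>^n\<close> descend from clustered cells of level \<open>n\<close>, of which there
  are at most \<open>B\<close>.
\<close>

lemma card_coords_in_ball:
  assumes B: "\<And>n Q. Q \<subseteq> coords n \<Longrightarrow>
      (\<And>c c' i. c \<in> Q \<Longrightarrow> c' \<in> Q \<Longrightarrow> i < 3 \<Longrightarrow> \<bar>c i - c' i\<bar> \<le> 3 * lam ^ n) \<Longrightarrow> card Q \<le> B"
    and "n \<le> L" "\<rho> \<le> lam ^ n"
  shows "card {c \<in> coords L. cell_point L c z \<in> ball x \<rho>} \<le> B * card (coords (L - n))"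
proof -
  define X where "X = {c \<in> coords L. cell_point L c z \<in> ball x \<rho>}"
  let ?g = "\<lambda>(d, e) i. d i + lam ^ n * e i"
  define Q where "Q = {d \<in> coords n. \<exists>e\<in>coords (L - n). ?g (d, e) \<in> X}"
  have "X \<subseteq> ?g ` (Q \<times> coords (L - n))"
  proof
    fix c assume c: "c \<in> X"
    then have "c \<in> coords (n + (L - n))" using \<open>n \<le> L\<close> by (simp add: X_def)
    from coords_split[OF this] obtain d e where
      de: "d \<in> coords n" "e \<in> coords (L - n)" "c = ?g (d, e)" by auto
    then have "d \<in> Q" using c unfolding Q_def by blast
    then show "c \<in> ?g ` (Q \<times> coords (L - n))" using de(2,3) by blast
  qed
  moreover have fin: "finite (Q \<times> coords (L - n))"
    using finite_coords by (auto simp: Q_def)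
  ultimately have "card X \<le> card (?g ` (Q \<times> coords (L - n)))"
    by (intro card_mono finite_imageI)
  also have "\<dots> \<le> card (Q \<times> coords (L - n))" using fin by (rule card_image_le)
  also have "\<dots> = card Q * card (coords (L - n))" by (rule card_cartesian_product)
  also have "card Q \<le> B"
  proof (rule B[of Q n])
    show "Q \<subseteq> coords n" by (auto simp: Q_def)
    fix d d' :: "nat \<Rightarrow> real" and i :: nat assume d: "d \<in> Q" "d' \<in> Q" and i: "i < 3"
    obtain e where e: "e \<in> coords (L - n)" "?g (d, e) \<in> X" using d(1) unfolding Q_def by blast
    obtain e' where e': "e' \<in> coords (L - n)" "?g (d', e') \<in> X" using d(2) unfolding Q_def by blast
    have "\<bar>?g (d, e) i - ?g (d', e') i\<bar> \<le>
        dist (cell_point L (?g (d, e)) z) (cell_point L (?g (d', e')) z)"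
      using e(2) e'(2) i unfolding X_def by (intro coord_le_dist_cell_point) blast+
    also have "\<dots> \<le> dist (cell_point L (?g (d, e)) z) x + dist (cell_point L (?g (d', e')) z) x"
      by (rule dist_triangle2)
    also have "\<dots> \<le> \<rho> + \<rho>"
      using e(2) e'(2) unfolding X_def by (intro add_mono) (auto simp: dist_commute)
    finally have "\<bar>(d i - d' i) + lam ^ n * (e i - e' i)\<bar> \<le> 2 * \<rho>"
      by (simp add: algebra_simps)
    moreover have "\<bar>e i - e' i\<bar> \<le> 1"
      using coords_bounds[OF e(1), of i] coords_bounds[OF e'(1), of i] power_bounds(1)[of "L - n"]
      by linarith
    then have "\<bar>lam ^ n * (e i - e' i)\<bar> \<le> lam ^ n * 1"
      unfolding abs_mult using power_bounds(1)[of n] by (intro mult_mono) auto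
    ultimately show "\<bar>d i - d' i\<bar> \<le> 3 * lam ^ n" using \<open>\<rho> \<le> lam ^ n\<close> by linarith
  qed
  finally show ?thesis unfolding X_def by simp
qed

text \<open>
  A finite subcover by balls of radius about \<open>\<lambda>^(n i)\<close> contains all \<open>q(L)\<close> cells of a level \<open>L\<close> deeper
  than all \<open>n i\<close>, while the ball \<open>i\<close> contains at most \<open>B q(L - n i) \<le> B t^(n i) q(L)\<close> of them. Hence
  \<open>1 \<le> B \<Sum> t^(n i)\<close>, which is a lower bound for \<open>\<Sum> diam^s\<close>.
\<close>

lemma hausdorff_measure_invariant_set_nonzero:
  fixes s t :: real
  assumes t: "0 < t" "1 + 3 * t ^ Suc m \<le> 3 * t" and s: "0 \<le> s" "t \<le> lam powr s"
  shows "hausdorff_measure s (invariant_set lam) \<noteq> 0"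
proof
  assume null: "hausdorff_measure s (invariant_set lam) = 0"
  obtain B :: nat where B: "\<And>n Q. Q \<subseteq> coords n \<Longrightarrow>
    (\<And>c c' i. c \<in> Q \<Longrightarrow> c' \<in> Q \<Longrightarrow> i < 3 \<Longrightarrow> \<bar>c i - c' i\<bar> \<le> 3 * lam ^ n) \<Longrightarrow> card Q \<le> B"
    using card_clustered_coords by blast
  define C where "C = real B / lam powr s"
  have C0: "0 \<le> C" by (simp add: C_def)
  \<comment> \<open>a total gauge for which the final bound \<open>1 \<le> C * e\<close> is contradictory\<close>
  define e where "e = 1 / (2 * C + 2)"
  have e0: "0 < e" using C0 by (simp add: e_def)
  obtain U where U: "U \<in> hausdorff_covers (1/2) (invariant_set lam)"
    "(\<Sum>i. hausdorff_gauge s (U i)) < ennreal (e / 2)"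
    using hausdorff_nullE[OF null, of "1/2" "e/2"] e0 by auto
  have tail: "(\<Sum>i. ennreal (e / 2 / 2 ^ Suc i)) = ennreal (e / 2)"
    using e0 by (intro suminf_ennreal_geometric) simp
  have Ubd: "bounded (U i)" "diameter (U i) \<le> 1/2" for i
    using U(1) unfolding hausdorff_covers_def by auto
  have Ucov: "invariant_set lam \<subseteq> (\<Union>i. U i)"
    using U(1) unfolding hausdorff_covers_def by blast
  define I where "I = {i. U i \<noteq> {}}"
  have "\<exists>\<rho> x n. U i \<subseteq> ball x \<rho> \<and> lam ^ Suc n < \<rho> \<and> \<rho> \<le> lam ^ n \<and>
      ennreal (\<rho> powr s) \<le> hausdorff_gauge s (U i) + ennreal (e / 2 / 2 ^ Suc i)"
    if i: "i \<in> I" for i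
  proof -
    have "U i \<noteq> {}" using i by (simp add: I_def)
    moreover have "diameter (U i) < 1" using Ubd(2)[of i] by simp
    moreover have "0 < e / 2 / 2 ^ Suc i" using e0 by simp
    ultimately obtain \<rho> where \<rho>: "diameter (U i) < \<rho>" "0 < \<rho>" "\<rho> < 1"
      "ennreal (\<rho> powr s) \<le> hausdorff_gauge s (U i) + ennreal (e / 2 / 2 ^ Suc i)"
      using radius_of_gauge[OF Ubd(1) _ _ s(1)] by blast
    obtain x where x: "x \<in> U i" using i by (auto simp: I_def)
    have "U i \<subseteq> ball x \<rho>"
      using diameter_bounded_bound[OF Ubd(1)[of i] x] \<rho>(1) by fastforce
    moreover obtain n where "lam ^ Suc n < \<rho>" "\<rho> \<le> lam ^ n"
      using level_of_radius[OF \<rho>(2,3)] .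
    ultimately show ?thesis using \<rho>(4) by blast
  qed
  then obtain \<rho> x n where ball: "\<And>i. i \<in> I \<Longrightarrow> U i \<subseteq> ball (x i) (\<rho> i)"
    and n: "\<And>i. i \<in> I \<Longrightarrow> lam ^ Suc (n i) < \<rho> i" "\<And>i. i \<in> I \<Longrightarrow> \<rho> i \<le> lam ^ n i"
    and gauge: "\<And>i. i \<in> I \<Longrightarrow>
      ennreal (\<rho> i powr s) \<le> hausdorff_gauge s (U i) + ennreal (e / 2 / 2 ^ Suc i)"
    by metis
  have "invariant_set lam \<subseteq> (\<Union>i\<in>I. ball (x i) (\<rho> i))"
  proof
    fix y assume "y \<in> invariant_set lam"
    then obtain i where "y \<in> U i" using Ucov by blast
    then have "i \<in> I" by (auto simp: I_def)
    then show "y \<in> (\<Union>i\<in>I. ball (x i) (\<rho> i))" using \<open>y \<in> U i\<close> ball by blast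
  qed
  then obtain J where J: "J \<subseteq> I" "finite J" "invariant_set lam \<subseteq> (\<Union>i\<in>J. ball (x i) (\<rho> i))"
    using compactE_image[OF compact_invariant_set, of I "\<lambda>i. ball (x i) (\<rho> i)"] by auto
  \<comment> \<open>any common upper bound of the levels would do\<close>
  define L where "L = (\<Sum>i\<in>J. n i)"
  have nL: "n i \<le> L" if "i \<in> J" for i
    unfolding L_def using that J(2) by (intro member_le_sum) auto
  obtain z where z: "z \<in> invariant_set lam"
  proof -
    have "(\<lambda>_. 0) \<in> address_space" by (simp add: address_space_def)
    then show thesis using that unfolding invariant_set_eq by blast
  qed
  let ?X = "\<lambda>i. {c \<in> coords L. cell_point L c z \<in> ball (x i) (\<rho> i)}"
  have "coords L \<subseteq> (\<Union>i\<in>J. ?X i)"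
    using cell_point_in_invariant_set[OF _ z] J(3) by blast
  then have "card (coords L) \<le> card (\<Union>i\<in>J. ?X i)"
    using J(2) finite_coords by (intro card_mono) auto
  also have "\<dots> \<le> (\<Sum>i\<in>J. card (?X i))" using J(2) by (rule card_UN_le)
  also have "\<dots> \<le> (\<Sum>i\<in>J. B * card (coords (L - n i)))"
    using J(1) n(2) nL by (intro sum_mono card_coords_in_ball[OF B]) auto
  finally have "real (card (coords L)) \<le> (\<Sum>i\<in>J. real (B * card (coords (L - n i))))"
    unfolding of_nat_sum[symmetric] by (rule of_nat_mono)
  also have "\<dots> \<le> (\<Sum>i\<in>J. C * \<rho> i powr s * card (coords L))"
  proof (rule sum_mono)
    fix i assume i: "i \<in> J"
    have "real (card (coords (L - n i))) \<le> t ^ n i * card (coords L)"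
      using card_coords_descend[OF t, of "L - n i" "n i"] nL[OF i] by simp
    also have "\<dots> \<le> (lam powr s) ^ n i * card (coords L)"
      using t(1) s(2) by (intro mult_right_mono power_mono) auto
    also have "(lam powr s) ^ n i = (lam ^ Suc (n i)) powr s / lam powr s"
      using lam_pos by (simp add: powr_mult powr_powr powr_realpow[symmetric] mult.commute)
    also have "\<dots> \<le> \<rho> i powr s / lam powr s"
      using n(1)[of i] i J(1) s(1) lam_pos by (intro divide_right_mono powr_mono2) auto
    finally have "real (card (coords (L - n i))) \<le> \<rho> i powr s / lam powr s * card (coords L)"
      by (simp add: mult_right_mono)
    then have "real B * card (coords (L - n i)) \<le> real B * (\<rho> i powr s / lam powr s * card (coords L))"
      by (intro mult_left_mono) auto
    then show "real (B * card (coords (L - n i))) \<le> C * \<rho> i powr s * card (coords L)"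
      by (simp add: C_def)
  qed
  also have "\<dots> = C * (\<Sum>i\<in>J. \<rho> i powr s) * card (coords L)"
    by (simp add: sum_distrib_left sum_distrib_right)
  finally have "1 \<le> C * (\<Sum>i\<in>J. \<rho> i powr s)"
    using card_coords_pos[of L] by simp
  also have "(\<Sum>i\<in>J. \<rho> i powr s) \<le> e"
  proof -
    have "ennreal (\<Sum>i\<in>J. \<rho> i powr s) = (\<Sum>i\<in>J. ennreal (\<rho> i powr s))" by simp
    also have "\<dots> \<le> (\<Sum>i\<in>J. hausdorff_gauge s (U i) + ennreal (e / 2 / 2 ^ Suc i))"
      using gauge J(1) by (intro sum_mono) blast
    also have "\<dots> = (\<Sum>i\<in>J. hausdorff_gauge s (U i)) + (\<Sum>i\<in>J. ennreal (e / 2 / 2 ^ Suc i))"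
      by (rule sum.distrib)
    also have "\<dots> \<le> (\<Sum>i. hausdorff_gauge s (U i)) + (\<Sum>i. ennreal (e / 2 / 2 ^ Suc i))"
      using J(2) by (intro add_mono sum_le_suminf) auto
    also have "\<dots> \<le> ennreal (e / 2) + ennreal (e / 2)"
    proof (rule add_mono)
      show "(\<Sum>i. hausdorff_gauge s (U i)) \<le> ennreal (e / 2)" using U(2) by (rule less_imp_le)
      show "(\<Sum>i. ennreal (e / 2 / 2 ^ Suc i)) \<le> ennreal (e / 2)"
        unfolding tail by (rule order.refl)
    qed
    also have "\<dots> = ennreal (e / 2 + e / 2)"
      using e0 by (intro ennreal_plus[symmetric]) linarith+
    also have "e / 2 + e / 2 = e" by (rule field_sum_of_halves)
    finally show ?thesis using e0 by simp
  qed
  then have "C * (\<Sum>i\<in>J. \<rho> i powr s) \<le> C * e" using C0 by (rule mult_left_mono)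
  finally have "1 \<le> C * e" .
  then show False using C0 by (simp add: e_def field_simps)
qed

lemma hausdorff_dim_invariant_ge:
  fixes s t :: real
  assumes "0 < t" "1 + 3 * t ^ Suc m \<le> 3 * t" "lam powr s = t"
  shows "ennreal s \<le> hausdorff_dim (invariant_set lam)"
proof (rule hausdorff_dim_ge)
  fix r assume "0 \<le> r" "r < s"
  then have "t \<le> lam powr r"
    using assms(3) lam_pos lam_less_1 by (auto intro: powr_mono')
  with assms(1,2) \<open>0 \<le> r\<close> show "hausdorff_measure r (invariant_set lam) \<noteq> 0"
    by (intro hausdorff_measure_invariant_set_nonzero)
qed

section \<open>Comparison of the growth rates\<close>

text \<open>
  At the root \<open>t\<^sub>0\<close> of \<open>2(t + \<dots> + t^(m-1)) = 1\<close> the geometric sum gives \<open>3t\<^sub>0 = 1 + 2t\<^sub>0^m\<close>, and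
  \<open>3t\<^sub>0^(m+1) < 2t\<^sub>0^m\<close> because \<open>t\<^sub>0 \<le> 1/2\<close>. The strict inequality survives a small decrease of \<open>t\<^sub>0\<close>.
\<close>

lemma growth_rates_differ:
  obtains t t' :: real where "0 < t" "t < t'" "t' < 1"
    "1 + 3 * t ^ Suc m \<le> 3 * t" "2 * (\<Sum>r=1..<m. t' ^ r) < 1"
proof -
  define p :: "real \<Rightarrow> real" where "p x = 2 * (\<Sum>r=1..<m. x ^ r)" for x
  have cont: "continuous_on S p" for S unfolding p_def by (intro continuous_intros)
  have "(1/2) ^ 1 \<le> (\<Sum>r=1..<m. (1/2::real) ^ r)"
    using m_ge_2 by (intro member_le_sum) auto
  then have "1 \<le> p (1/2)" by (simp add: p_def)
  moreover have "p 0 \<le> 1" by (simp add: p_def power_0_left)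
  ultimately obtain t\<^sub>0 where t0: "0 \<le> t\<^sub>0" "t\<^sub>0 \<le> 1/2" "p t\<^sub>0 = 1"
    using IVT'[of p 0 1 "1/2"] cont by auto
  have "t\<^sub>0 \<noteq> 0" using t0(3) by (auto simp: p_def power_0_left)
  then have t0pos: "0 < t\<^sub>0" using t0(1) by simp
  have "(1 - t\<^sub>0) * (\<Sum>r=1..<m. t\<^sub>0 ^ r) = t\<^sub>0 - t\<^sub>0 ^ m"
  proof -
    have "{1..<m} = {1..m - 1}" using m_ge_2 by auto
    then show ?thesis using sum_gp_multiplied[of 1 "m - 1" t\<^sub>0] m_ge_2 by simp
  qed
  moreover have "(\<Sum>r=1..<m. t\<^sub>0 ^ r) = 1/2" using t0(3) by (simp add: p_def)
  ultimately have "(1 - t\<^sub>0) * (1/2) = t\<^sub>0 - t\<^sub>0 ^ m" by (simp only:)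
  then have "3 * t\<^sub>0 = 1 + 2 * t\<^sub>0 ^ m" by (simp add: field_simps)
  moreover have "t\<^sub>0 ^ m * (3 * t\<^sub>0) < t\<^sub>0 ^ m * 2"
    using t0pos t0(2) by (intro mult_strict_left_mono) auto
  then have "3 * t\<^sub>0 ^ Suc m < 2 * t\<^sub>0 ^ m" by (simp only: power_Suc mult_ac)
  ultimately have gap: "1 + 3 * t\<^sub>0 ^ Suc m < 3 * t\<^sub>0" by linarith
  have "((\<lambda>x. 3 * x - (1 + 3 * x ^ Suc m)) \<longlongrightarrow> 3 * t\<^sub>0 - (1 + 3 * t\<^sub>0 ^ Suc m)) (at_left t\<^sub>0)"
    by (intro tendsto_intros)
  then have "\<forall>\<^sub>F x in at_left t\<^sub>0. 0 < 3 * x - (1 + 3 * x ^ Suc m)"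
    using gap by (intro order_tendstoD(1)) auto
  moreover have "\<forall>\<^sub>F x in at_left t\<^sub>0. 0 < x \<and> x < t\<^sub>0"
    using eventually_at_left_real[OF t0pos] by (auto elim: eventually_mono)
  ultimately have "\<forall>\<^sub>F x in at_left t\<^sub>0. 0 < 3 * x - (1 + 3 * x ^ Suc m) \<and> 0 < x \<and> x < t\<^sub>0"
    by (rule eventually_conj)
  then obtain t where t: "0 < 3 * t - (1 + 3 * t ^ Suc m)" "0 < t" "t < t\<^sub>0"
    using eventually_happens trivial_limit_at_left_real by blast
  define t' where "t' = (t + t\<^sub>0) / 2"
  have t': "t < t'" "t' < t\<^sub>0" using t(3) by (simp_all add: t'_def)
  have "(\<Sum>r=1..<m. t' ^ r) < (\<Sum>r=1..<m. t\<^sub>0 ^ r)"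
    using m_ge_2 t(2) t' by (intro sum_strict_mono power_strict_mono) auto
  then have "2 * (\<Sum>r=1..<m. t' ^ r) < 1" using t0(3) by (simp add: p_def)
  then show thesis using that[of t t'] t t' t0(2) by simp
qed

lemma hausdorff_dim_uniqueness_less:
  "hausdorff_dim (uniqueness_set lam) < hausdorff_dim (invariant_set lam)"
proof -
  obtain t t' :: real where t: "0 < t" "t < t'" "t' < 1"
    "1 + 3 * t ^ Suc m \<le> 3 * t" "2 * (\<Sum>r=1..<m. t' ^ r) < 1"
    by (rule growth_rates_differ)
  \<comment> \<open>a third rate, since the number of words times \<open>(\<lambda>^s)^n\<close> must tend to 0 and not just stay bounded\<close>
  define t'' where "t'' = (t + t') / 2"
  have t'': "t < t''" "t'' < t'" using t(2) by (simp_all add: t''_def)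
  have powr: "lam powr (log lam u) = u" if "0 < u" for u :: real
    using that lam_pos lam_less_1 by simp
  have anti: "log lam v < log lam u" if "0 < u" "u < v" for u v :: real
    using that lam_pos lam_less_1 by (simp add: log_def divide_strict_right_mono_neg)
  have "0 < log lam t''"
    using anti[of t'' 1] t t'' by simp
  then have "hausdorff_dim (uniqueness_set lam) \<le> ennreal (log lam t'')"
    using t t'' powr[of t''] by (intro hausdorff_dim_uniqueness_le[of t']) auto
  also have "\<dots> < ennreal (log lam t)"
    using anti[OF t(1) t''(1)] \<open>0 < log lam t''\<close> by (intro ennreal_lessI) auto
  also have "\<dots> \<le> hausdorff_dim (invariant_set lam)"
    using t(1,4) powr by (intro hausdorff_dim_invariant_ge) auto
  finally show ?thesis .
qed

end

lemma multinacci_root: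
  assumes "2 \<le> m"
  shows "0 < multinacci m" "multinacci m < 1" "(\<Sum>k=1..m. multinacci m ^ k) = 1"
proof -
  define p :: "real \<Rightarrow> real" where "p x = (\<Sum>k=1..m. x ^ k)" for x
  have mono: "p x < p y" if "0 \<le> x" "x < y" for x y
    unfolding p_def using that assms by (intro sum_strict_mono power_strict_mono) auto
  have p1: "p 1 = m" by (simp add: p_def)
  have "p 0 = 0" by (simp add: p_def power_0_left)
  moreover have "continuous_on {0..1} p" unfolding p_def by (intro continuous_intros)
  ultimately obtain x where x: "0 \<le> x" "x \<le> 1" "p x = 1"
    using IVT'[of p 0 1 1] p1 assms by auto
  have "x \<noteq> 0" "x \<noteq> 1" using x(3) p1 \<open>p 0 = 0\<close> assms by auto
  then have root: "0 < x" "x < 1" using x by auto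
  have "multinacci m = x"
    unfolding multinacci_def
  proof (rule the_equality)
    show "0 < x \<and> (\<Sum>k=1..m. x ^ k) = 1" using root x(3) by (simp add: p_def)
    fix y :: real assume "0 < y \<and> (\<Sum>k=1..m. y ^ k) = 1"
    then have "0 < y" "p y = 1" by (simp_all add: p_def)
    then show "y = x" using mono[of x y] mono[of y x] root(1) x(3) by (metis less_irrefl linorder_cases less_imp_le)
  qed
  then show "0 < multinacci m" "multinacci m < 1" "(\<Sum>k=1..m. multinacci m ^ k) = 1"
    using root x(3) by (simp_all add: p_def)
qed

theorem propositionA5:
  fixes m :: nat
  assumes "2 \<le> m"
  shows "hausdorff_dim (less_than_continuum_set (multinacci m)) =
           hausdorff_dim (uniqueness_set (multinacci m)) \<and>
         hausdorff_dim (uniqueness_set (multinacci m)) <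
           hausdorff_dim (invariant_set (multinacci m))"
proof -
  interpret multinacci_ratio "multinacci m" m
    using multinacci_root[OF assms] assms by unfold_locales
  show ?thesis
    using hausdorff_dim_less_than_continuum_eq hausdorff_dim_uniqueness_less by blast
qed

end
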